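(* Let $\kappa=[2\ell]$ for some $\ell\in\mathbb Z$, let $t=F+\check E+\kappa K^{-1}$, and define for $a\ge0$ $$\dot t^{(2a)}=\frac{t}{[2a]!}\prod_{j=-a+1}^{a-1}\bigl(t-[2j]\bigr),\qquad \dot t^{(2a+1)}=\frac{1}{[2a+1]!}\prod_{j=-a}^{a}\bigl(t-[2j]\bigr).$$ (1) Let $n\in\mathbb N$. For every integer $\lambda$ sufficiently large compared to $n$, the element $\dot t^{(n)}v^+_{2\lambda}$ is an $\imath$-canonical basis element of $L(2\lambda)$. (2) The set $\{\dot t^{(n)}\mid n\in\mathbb N\}$ is the $\imath$-canonical basis of $\mathbf U^\imath$ for even weights, and it is an $\mathcal A$-basis of ${}_{\mathcal A}\mathbf U^\imath_{\rm ev}$.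
   Context: $q$ is an indeterminate, $\mathcal A=\mathbb Z[q,q^{-1}]$, $[n]=\frac{q^n-q^{-n}}{q-q^{-1}}$, $[n]!=[1]\cdots[n]$, $[0]!=1$. $\mathbf U$ is the $\mathbb Q(q)$-algebra generated by $E,F,K^{\pm1}$ with relations $KK^{-1}=K^{-1}K=1$, $EF-FE=\frac{K-K^{-1}}{q-q^{-1}}$, $KE=q^2EK$, $KF=q^{-2}FK$; $\check E=q^{-1}EK^{-1}$, $F^{(n)}=F^n/[n]!$. $\mathbf U^\imath$ is the $\mathbb Q(q)$-subalgebra of $\mathbf U$ generated by $t$ (a polynomial algebra in $t$), and $\psi_\imath$ is the ring involution of $\mathbf U^\imath$ fixing $t$ and sending $q\mapsto q^{-1}$. For $\mu\in\mathbb N$, $L(\mu)$ is the simple $\mathbf U$-module of highest weight $\mu$ with highest weight vector $v^+_\mu$; it has basis $\{F^{(a)}v^+_\mu\}_{0\le a\le\mu}$ whose $\mathcal A$-span is $L(\mu)_{\mathcal A}$. The $\imath$-bar involution $\psi_\imath$ on $L(\mu)$ is the $q\mapsto q^{-1}$ semilinear map with $\psi_\imath(xv^+_\mu)=\psi_\imath(x)v^+_\mu$ for $x\in\mathbf U^\imath$. For $0\le a\le\mu$ the $\imath$-canonical basis element $b^\mu_a\in L(\mu)$ is the unique element with $\psi_\imath(b^\mu_a)=b^\mu_a$ and $b^\mu_a\in F^{(a)}v^+_\mu+\sum_{0\le r<a}q^{-1}\mathbb Z[q^{-1}]F^{(r)}v^+_\mu$ (these exist by Bao–Wang); they form the $\imath$-canonical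 basis of $L(\mu)$. ${}_{\mathcal A}\mathbf U^\imath_{\rm ev}=\{x\in\mathbf U^\imath: xv\in L(\mu)_{\mathcal A}\ \forall v\in L(\mu)_{\mathcal A},\ \forall \mu\in 2\mathbb N\}$. The $\imath$-canonical basis of $\mathbf U^\imath$ for even weights (Bao–Wang) is the family $\{B_n\}_{n\in\mathbb N}\subset{}_{\mathcal A}\mathbf U^\imath_{\rm ev}$ characterized by: for each $n$, $B_nv^+_{2\lambda}=b^{2\lambda}_n$ for all $\lambda\gg0$.
   Formalization: The formula for ṫ^{(2a)} is used only for a ≥ 1, and ṫ^{(0)} is set to 1; read literally at a = 0 it gives t, so every ṫ^{(n)} would be divisible by t and 1 would not be in their span, contradicting part (2). *)

theory Defs
  imports "HOL-Computational_Algebra.Polynomial" "HOL-Computational_Algebra.Fraction_Field"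
begin

type_synonym qf = "rat poly fract"

definition qq :: qf where "qq = Fract [:0, 1:] 1"

definition qint :: "int \<Rightarrow> qf" where
  "qint n = (qq powi n - qq powi (- n)) / (qq - inverse qq)"

definition qfact :: "nat \<Rightarrow> qf" where
  "qfact n = (\<Prod>i = 1..n. qint (int i))"

definition ipoly :: "int poly \<Rightarrow> qf \<Rightarrow> qf" where
  "ipoly p x = poly (map_poly of_int p) x"

definition inA :: "qf \<Rightarrow> bool" where
  "inA x \<longleftrightarrow> (\<exists>(p::int poly) (k::nat). x = ipoly p qq / qq ^ k)"

definition in_qinvZqinv :: "qf \<Rightarrow> bool" where
  "in_qinvZqinv x \<longleftrightarrow> (\<exists>p::int poly. coeff p 0 = 0 \<and> x = ipoly p (inverse qq))"

definition fbar :: "qf \<Rightarrow> qf" where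
  "fbar x = (case (SOME (a, b). b \<noteq> 0 \<and> x = Fract a b) of (a, b) \<Rightarrow>
      poly (map_poly (\<lambda>c. Fract [:c:] 1) a) (inverse qq) /
      poly (map_poly (\<lambda>c. Fract [:c:] 1) b) (inverse qq))"

text \<open>Elements of L(mu) are coordinate vectors w.r.t. the basis F^{(a)} v^+_mu, a = 0..mu:
  functions v :: nat \<Rightarrow> qf with v a = 0 for a > mu.\<close>
definition inL :: "nat \<Rightarrow> (nat \<Rightarrow> qf) \<Rightarrow> bool" where
  "inL mu v \<longleftrightarrow> (\<forall>a>mu. v a = 0)"

definition inLA :: "nat \<Rightarrow> (nat \<Rightarrow> qf) \<Rightarrow> bool" where
  "inLA mu v \<longleftrightarrow> inL mu v \<and> (\<forall>a. inA (v a))"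

definition vplus :: "nat \<Rightarrow> qf" where
  "vplus = (\<lambda>a. if a = 0 then 1 else 0)"

text \<open>Action of t = F + q^{-1} E K^{-1} + kappa K^{-1} on L(mu), using the standard formulas
  F F^{(a)}v = [a+1] F^{(a+1)}v, E F^{(a)}v = [mu-a+1] F^{(a-1)}v, K F^{(a)}v = q^{mu-2a} F^{(a)}v.\<close>
definition t_act :: "qf \<Rightarrow> nat \<Rightarrow> (nat \<Rightarrow> qf) \<Rightarrow> (nat \<Rightarrow> qf)" where
  "t_act \<kappa> mu v = (\<lambda>a. if a \<le> mu then
       (if a \<ge> 1 then qint (int a) * v (a - 1) else 0)
     + (if a + 1 \<le> mu then qq powi (1 - int mu + 2 * int a) * qint (int mu - int a) * v (a + 1) else 0)
     + \<kappa> * qq powi (- (int mu - 2 * int a)) * v a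
     else 0)"

text \<open>Elements of U^imath are polynomials in t over Q(q); their action on L(mu).\<close>
definition act :: "qf \<Rightarrow> nat \<Rightarrow> qf poly \<Rightarrow> (nat \<Rightarrow> qf) \<Rightarrow> (nat \<Rightarrow> qf)" where
  "act \<kappa> mu p v = (\<lambda>a. \<Sum>i\<le>degree p. coeff p i * (t_act \<kappa> mu ^^ i) v a)"

definition ipsiU :: "qf poly \<Rightarrow> qf poly" where
  "ipsiU p = map_poly fbar p"

definition ipsiL :: "qf \<Rightarrow> nat \<Rightarrow> (nat \<Rightarrow> qf) \<Rightarrow> (nat \<Rightarrow> qf)" where
  "ipsiL \<kappa> mu v = act \<kappa> mu (ipsiU (SOME p. act \<kappa> mu p vplus = v)) vplus"

definition is_icb :: "qf \<Rightarrow> nat \<Rightarrow> nat \<Rightarrow> (nat \<Rightarrow> qf) \<Rightarrow> bool" where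
  "is_icb \<kappa> mu a b \<longleftrightarrow> inL mu b \<and> ipsiL \<kappa> mu b = b \<and> b a = 1 \<and>
     (\<forall>r<a. in_qinvZqinv (b r)) \<and> (\<forall>r>a. b r = 0)"

definition icb :: "qf \<Rightarrow> nat \<Rightarrow> nat \<Rightarrow> (nat \<Rightarrow> qf)" where
  "icb \<kappa> mu a = (THE b. is_icb \<kappa> mu a b)"

definition is_icb_element :: "qf \<Rightarrow> nat \<Rightarrow> (nat \<Rightarrow> qf) \<Rightarrow> bool" where
  "is_icb_element \<kappa> mu b \<longleftrightarrow> (\<exists>a\<le>mu. b = icb \<kappa> mu a)"

definition AUev :: "qf \<Rightarrow> qf poly set" where
  "AUev \<kappa> = {x. \<forall>lam v. inLA (2 * lam) v \<longrightarrow> inLA (2 * lam) (act \<kappa> (2 * lam) x v)}"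

text \<open>The imath-divided powers dot t^{(n)} as polynomials in t (with the standard convention
  dot t^{(0)} = 1; the even-case formula is used for n = 2a with a \<ge> 1).\<close>
definition dot_t :: "nat \<Rightarrow> qf poly" where
  "dot_t n = (if n = 0 then 1 else if even n then
      (let a = int (n div 2) in
        smult (inverse (qfact n)) ([:0, 1:] * (\<Prod>j\<in>{-a+1..a-1}. [:0, 1:] - [:qint (2 * j):])))
    else
      (let a = int (n div 2) in
        smult (inverse (qfact n)) (\<Prod>j\<in>{-a..a}. [:0, 1:] - [:qint (2 * j):])))"

end

theory Submission
  imports Defs
begin

text \<open>
  Let \<open>e(n,k) = \<Prod>j<n. (t - [2(k-j)]) / [n]!\<close>. A Pascal-type identity relates \<open>e(n,k)\<close> to
  \<open>e(n,k-1)\<close> and \<open>e(n-1,k-1)\<close>, so the \<open>\<A>\<close>-span of \<open>{e(n,k) | n}\<close> does not depend on the integer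
  \<open>k\<close>, and \<open>e(m,k) e(n,k-m)\<close> is a q-binomial multiple of \<open>e(m+n,k)\<close>, so this span is a ring.
  It contains the divided powers. For \<open>k = l + \<lambda>\<close> the vector \<open>e(n,k) v\<^sup>+\<close> in \<open>L(2\<lambda>)\<close> has a closed form,
  unitriangular over \<open>\<A>\<close>, and vanishes for \<open>n = 2\<lambda> + 1\<close>. Hence the ring applied to \<open>v\<^sup>+\<close> is all of
  \<open>L(2\<lambda>)\<^sub>\<A>\<close>, the ring preserves this lattice, and the annihilator of \<open>v\<^sup>+\<close> is generated by the
  bar invariant polynomial \<open>e(2\<lambda>+1,k)\<close>, which makes the bar involution of \<open>L(2\<lambda>)\<close> well defined.

  The three-term recursion \<open>[n+1] d(n+1) = t d(n) - [n] d(n-1)\<close> (last term for even \<open>n\<close> only) of the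
  divided powers shows that the lower coefficients of \<open>d(n) v\<^sup>+\<close> have negative degree in \<open>q\<close> once
  \<open>2\<lambda> \<ge> 2|l| + n\<close>; being in \<open>\<A>\<close>, they lie in \<open>q\<^sup>-\<^sup>1\<int>[q\<^sup>-\<^sup>1]\<close>.
  Spanning follows by induction on the degree, since the coefficient of \<open>F\<^sup>(\<^sup>n\<^sup>)v\<^sup>+\<close> in \<open>x v\<^sup>+\<close> is \<open>[n]!\<close>
  times the leading coefficient of \<open>x\<close>.
\<close>

section \<open>Ring homomorphisms on polynomials\<close>

text \<open>Three maps are instances: the embedding of the rational constants,
  \<open>of_int\<close>, and \<open>fbar\<close>. The facts about \<open>map_poly\<close> turn
  evaluation, and later \<open>ipsiU\<close>, into ring homomorphisms.\<close>

locale comm_ring_hom_fun =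
  fixes f :: "'a::comm_ring_1 \<Rightarrow> 'b::comm_ring_1"
  assumes hom_add: "f (x + y) = f x + f y"
    and hom_mult: "f (x * y) = f x * f y"
    and hom_one: "f 1 = 1"
begin

lemma hom_zero: "f 0 = 0"
  using hom_add[of 0 0] by simp

lemma hom_uminus: "f (- x) = - f x"
  using hom_add[of x "- x"] by (simp add: hom_zero eq_neg_iff_add_eq_0 add.commute)

lemma hom_diff: "f (x - y) = f x - f y"
  using hom_add[of x "- y"] by (simp add: hom_uminus)

lemma hom_sum: "f (sum g S) = (\<Sum>i\<in>S. f (g i))"
  by (induction S rule: infinite_finite_induct) (auto simp: hom_zero hom_add)

lemma map_poly_hom_add: "map_poly f (p + r) = map_poly f p + map_poly f r"
  by (rule poly_eqI) (simp add: coeff_map_poly hom_zero hom_add)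

lemma map_poly_hom_diff: "map_poly f (p - r) = map_poly f p - map_poly f r"
  by (rule poly_eqI) (simp add: coeff_map_poly hom_zero hom_diff)

lemma map_poly_hom_mult: "map_poly f (p * r) = map_poly f p * map_poly f r"
  by (rule poly_eqI) (simp add: coeff_map_poly hom_zero hom_sum hom_mult coeff_mult)

lemma map_poly_hom_smult: "map_poly f (smult c p) = smult (f c) (map_poly f p)"
  by (rule poly_eqI) (simp add: coeff_map_poly hom_zero hom_mult)

lemma map_poly_hom_pCons: "map_poly f (pCons c p) = pCons (f c) (map_poly f p)"
  by (rule poly_eqI) (simp add: coeff_map_poly hom_zero coeff_pCons split: nat.split)

lemma map_poly_hom_one: "map_poly f 1 = 1"
  by (rule poly_eqI) (simp add: coeff_map_poly hom_zero hom_one)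

lemma map_poly_hom_prod: "map_poly f (prod g S) = (\<Prod>i\<in>S. map_poly f (g i))"
  by (induction S rule: infinite_finite_induct) (auto simp: map_poly_hom_one map_poly_hom_mult)

end

section \<open>The field of rational functions in q\<close>

interpretation const_fract: comm_ring_hom_fun "\<lambda>c::rat. Fract [:c:] 1"
  by unfold_locales (auto simp: One_fract_def one_pCons mult.commute)

interpretation of_int_qf: comm_ring_hom_fun "of_int :: int \<Rightarrow> qf"
  by unfold_locales auto

lemma of_int_qf_eq_Fract: "(of_int i :: qf) = Fract [:of_int i:] 1"
proof -
  have n: "(of_nat k :: qf) = Fract [:of_nat k:] 1" for k
    by (induction k) (auto simp: Zero_fract_def One_fract_def one_pCons)
  show ?thesis
    by (cases i rule: int_diff_cases) (simp add: n)
qed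

lemma qq_nonzero [simp]: "qq \<noteq> 0"
  by (simp add: qq_def Zero_fract_def eq_fract)

lemma qq_power: "qq ^ n = Fract (monom 1 n) 1"
  by (induction n) (auto simp: qq_def One_fract_def monom_0 one_pCons monom_Suc)

lemma poly_const_fract_qq: "poly (map_poly (\<lambda>c. Fract [:c:] 1) a) qq = Fract a 1"
proof (induction a)
  case 0
  show ?case by (simp add: Zero_fract_def)
next
  case (pCons c a)
  have "Fract [:c:] 1 + Fract [:0, 1:] 1 * Fract a 1 = Fract (pCons c a) 1"
    by simp
  with pCons show ?case
    by (simp add: const_fract.map_poly_hom_pCons qq_def del: add_fract mult_fract)
qed

section \<open>The bar involution of Q(q)\<close>

definition bar_poly :: "rat poly \<Rightarrow> qf" where
  "bar_poly a = poly (map_poly (\<lambda>c. Fract [:c:] 1) a) (inverse qq)"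

lemma bar_poly_add: "bar_poly (a + b) = bar_poly a + bar_poly b"
  by (simp add: bar_poly_def const_fract.map_poly_hom_add)

lemma bar_poly_mult: "bar_poly (a * b) = bar_poly a * bar_poly b"
  by (simp add: bar_poly_def const_fract.map_poly_hom_mult)

lemma bar_poly_one: "bar_poly 1 = 1"
  by (simp add: bar_poly_def const_fract.map_poly_hom_one)

lemma bar_poly_pCons: "bar_poly (pCons c a) = Fract [:c:] 1 + inverse qq * bar_poly a"
  by (simp add: bar_poly_def const_fract.map_poly_hom_pCons)

text \<open>For large k the product q^k a(1/q) is a polynomial, nonzero if a is. This keeps the
  denominators in \<open>fbar\<close> from vanishing. The bound \<open>degree p \<le> k\<close>
  prevents the new top monomial from cancelling against p.\<close>

lemma bar_poly_clear_denominator: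
  "\<exists>k p. degree p \<le> k \<and> bar_poly a * qq ^ k = Fract p 1 \<and> (a \<noteq> 0 \<longrightarrow> p \<noteq> 0)"
proof (induction a)
  case 0
  show ?case by (intro exI[of _ 0] exI[of _ 0]) (simp add: bar_poly_def Zero_fract_def)
next
  case (pCons c a)
  then obtain k p where kp: "degree p \<le> k" "bar_poly a * qq ^ k = Fract p 1" "a \<noteq> 0 \<longrightarrow> p \<noteq> 0"
    by blast
  have "bar_poly (pCons c a) * qq ^ Suc k = Fract [:c:] 1 * qq ^ Suc k + bar_poly a * qq ^ k"
    by (simp add: bar_poly_pCons field_simps)
  also have "\<dots> = Fract (monom c (Suc k) + p) 1"
    using kp(2) by (simp add: qq_power smult_monom del: power_Suc)
  finally have eq: "bar_poly (pCons c a) * qq ^ Suc k = Fract (monom c (Suc k) + p) 1" .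
  have deg: "degree (monom c (Suc k) + p) \<le> Suc k"
    using kp(1) degree_monom_le[of c "Suc k"] by (intro degree_add_le) auto
  have nz: "monom c (Suc k) + p \<noteq> 0" if "pCons c a \<noteq> 0"
  proof (cases "c = 0")
    case True
    then show ?thesis using that kp(3) by simp
  next
    case False
    have "coeff (monom c (Suc k) + p) (Suc k) = c"
      using kp(1) by (simp add: coeff_eq_0)
    with False show ?thesis by (metis coeff_0)
  qed
  show ?case using eq deg nz by blast
qed

lemma bar_poly_eq_0_iff [simp]: "bar_poly a = 0 \<longleftrightarrow> a = 0"
proof
  assume z: "bar_poly a = 0"
  obtain k p where "bar_poly a * qq ^ k = Fract p 1" "a \<noteq> 0 \<longrightarrow> p \<noteq> 0"
    using bar_poly_clear_denominator by blast
  with z show "a = 0" by (metis Zero_fract_def eq_fract(1) mult_1_right mult_zero_left zero_neq_one)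
qed (simp add: bar_poly_def)

text \<open>Cross-multiplication survives the multiplicative map \<open>bar_poly\<close>, so every
  representing fraction picked by \<open>SOME\<close> gives the same value.\<close>

lemma fbar_Fract:
  assumes "b \<noteq> 0"
  shows "fbar (Fract a b) = bar_poly a / bar_poly b"
proof -
  define P where "P = (\<lambda>(a', b'). b' \<noteq> 0 \<and> Fract a b = Fract a' b')"
  obtain a' b' where ab: "(SOME x. P x) = (a', b')" by (cases "SOME x. P x")
  have "P (a, b)" using assms by (simp add: P_def)
  hence "P (SOME x. P x)" by (rule someI)
  hence p: "b' \<noteq> 0" "Fract a b = Fract a' b'" unfolding ab by (auto simp: P_def)
  hence "a * b' = a' * b" using assms by (simp add: eq_fract)
  hence "bar_poly a * bar_poly b' = bar_poly a' * bar_poly b"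
    by (metis bar_poly_mult)
  hence e: "bar_poly a' / bar_poly b' = bar_poly a / bar_poly b"
    using p(1) assms by (simp add: frac_eq_eq)
  have "fbar (Fract a b) = bar_poly a' / bar_poly b'"
    using ab by (simp add: fbar_def P_def bar_poly_def)
  with e show ?thesis by simp
qed

interpretation fbar: comm_ring_hom_fun fbar
proof
  fix x y :: qf
  obtain a b where x: "x = Fract a b" "b \<noteq> 0" by (cases x) auto
  obtain c d where y: "y = Fract c d" "d \<noteq> 0" by (cases y) auto
  show "fbar (x + y) = fbar x + fbar y"
    using x y by (simp add: fbar_Fract bar_poly_add bar_poly_mult field_simps)
  show "fbar (x * y) = fbar x * fbar y"
    using x y by (simp add: fbar_Fract bar_poly_mult)
  show "fbar 1 = 1"
    by (simp add: One_fract_def fbar_Fract bar_poly_one)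
qed

lemma fbar_inverse: "fbar (inverse x) = inverse (fbar x)"
proof (cases "x = 0")
  case True
  then show ?thesis by (simp add: fbar.hom_zero)
next
  case False
  hence "fbar x * fbar (inverse x) = 1"
    by (simp flip: fbar.hom_mult add: fbar.hom_one)
  thus ?thesis by (metis inverse_unique)
qed

lemma fbar_divide: "fbar (x / y) = fbar x / fbar y"
  by (simp add: divide_inverse fbar.hom_mult fbar_inverse)

lemma fbar_qq: "fbar qq = inverse qq"
  by (simp add: qq_def fbar_Fract bar_poly_one bar_poly_pCons)
    (simp add: bar_poly_def const_fract.hom_zero flip: One_fract_def one_pCons)

lemma fbar_power: "fbar (x ^ n) = fbar x ^ n"
  by (induction n) (auto simp: fbar.hom_one fbar.hom_mult)

lemma fbar_powi: "fbar (x powi n) = fbar x powi n"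
  by (simp add: power_int_def fbar_power fbar_inverse)

lemma fbar_qint: "fbar (qint n) = qint n"
proof -
  have "fbar (qint n) = (inverse qq powi n - inverse qq powi (- n)) / (inverse qq - qq)"
    by (simp add: qint_def fbar_divide fbar.hom_diff fbar_powi fbar_qq fbar_inverse)
  also have "\<dots> = (- (qq powi n - qq powi (- n))) / (- (qq - inverse qq))"
    by (simp add: power_int_inverse power_int_minus)
  also have "\<dots> = qint n"
    by (simp only: minus_divide_divide qint_def)
  finally show ?thesis .
qed

lemma fbar_qfact: "fbar (qfact n) = qfact n"
  by (induction n) (auto simp: qfact_def fbar.hom_one fbar.hom_mult fbar_qint)

section \<open>Integral polynomials in q and the ring A of Laurent polynomials\<close>

lemma ipoly_add: "ipoly (p + r) x = ipoly p x + ipoly r x"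
  by (simp add: ipoly_def of_int_qf.map_poly_hom_add)

lemma ipoly_mult: "ipoly (p * r) x = ipoly p x * ipoly r x"
  by (simp add: ipoly_def of_int_qf.map_poly_hom_mult)

lemma ipoly_pCons: "ipoly (pCons c p) x = of_int c + x * ipoly p x"
  by (simp add: ipoly_def of_int_qf.map_poly_hom_pCons)

lemma ipoly_0 [simp]: "ipoly 0 x = 0"
  by (simp add: ipoly_def)

lemma ipoly_monom: "ipoly (monom c n) x = of_int c * x ^ n"
  by (simp add: ipoly_def map_poly_monom poly_monom)

lemma ipoly_qq: "ipoly p qq = Fract (map_poly of_int p) 1"
proof -
  have "map_poly (of_int :: int \<Rightarrow> qf) p = map_poly (\<lambda>c. Fract [:c:] 1) (map_poly of_int p)"
    by (rule poly_eqI) (simp add: coeff_map_poly of_int_qf_eq_Fract flip: Zero_fract_def)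
  thus ?thesis by (simp add: ipoly_def poly_const_fract_qq)
qed

lemma fbar_of_int: "fbar (of_int i) = of_int i"
proof -
  have n: "fbar (of_nat k) = of_nat k" for k
    by (induction k) (auto simp: fbar.hom_zero fbar.hom_one fbar.hom_add)
  show ?thesis
    by (cases i rule: int_diff_cases) (simp add: n fbar.hom_diff)
qed

lemma fbar_ipoly: "fbar (ipoly p x) = ipoly p (fbar x)"
  by (induction p) (auto simp: ipoly_pCons fbar.hom_zero fbar.hom_add fbar.hom_mult fbar_of_int)

lemma inA_ipoly: "inA (ipoly p qq)"
  unfolding inA_def by (intro exI[of _ p] exI[of _ 0]) simp

lemma ipoly_1 [simp]: "ipoly 1 x = 1"
  by (simp add: ipoly_def)

lemma inA_0 [simp]: "inA 0"
  using inA_ipoly[of 0] by simp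

lemma inA_1 [simp]: "inA 1"
  using inA_ipoly[of 1] by simp

lemma inA_add:
  assumes "inA x" "inA y"
  shows "inA (x + y)"
proof -
  obtain p k r m where "x = ipoly p qq / qq ^ k" "y = ipoly r qq / qq ^ m"
    using assms unfolding inA_def by blast
  hence "x + y = ipoly (p * monom 1 m + r * monom 1 k) qq / qq ^ (k + m)"
    by (simp add: ipoly_add ipoly_mult ipoly_monom power_add add_frac_eq)
  thus ?thesis unfolding inA_def by blast
qed

lemma inA_mult:
  assumes "inA x" "inA y"
  shows "inA (x * y)"
proof -
  obtain p k r m where "x = ipoly p qq / qq ^ k" "y = ipoly r qq / qq ^ m"
    using assms unfolding inA_def by blast
  hence "x * y = ipoly (p * r) qq / qq ^ (k + m)"
    by (simp add: ipoly_mult power_add)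
  thus ?thesis unfolding inA_def by blast
qed

lemma inA_uminus: "inA x \<Longrightarrow> inA (- x)"
proof -
  have "inA (- 1)" using inA_ipoly[of "monom (- 1) 0"] by (simp add: ipoly_monom)
  thus "inA x \<Longrightarrow> inA (- x)" using inA_mult[of "- 1" x] by simp
qed

lemma inA_diff: "inA x \<Longrightarrow> inA y \<Longrightarrow> inA (x - y)"
  using inA_add[of x "- y"] by (simp add: inA_uminus)

lemma inA_qq_powi: "inA (qq powi n)"
proof (cases "n \<ge> 0")
  case True
  have "inA (qq ^ nat n)" using inA_ipoly[of "monom 1 (nat n)"] by (simp add: ipoly_monom)
  thus ?thesis using True by (simp add: power_int_def)
next
  case False
  have "qq powi n = ipoly (monom 1 0) qq / qq ^ nat (- n)"
    using False by (simp add: ipoly_monom power_int_def divide_inverse power_inverse)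
  thus ?thesis unfolding inA_def by blast
qed

section \<open>Order at infinity\<close>

text \<open>This says x = O(q^d) as q tends to infinity. The fraction may be unreduced, since only
  the difference of the degrees matters.\<close>

definition pole_order_le :: "int \<Rightarrow> qf \<Rightarrow> bool" where
  "pole_order_le d x \<longleftrightarrow> (\<exists>a b. b \<noteq> 0 \<and> x * qq powi (- d) = Fract a b \<and> degree a \<le> degree b)"

lemma pole_order_le_add:
  assumes "pole_order_le d x" "pole_order_le d y"
  shows "pole_order_le d (x + y)"
proof -
  obtain a b where x: "b \<noteq> 0" "x * qq powi (- d) = Fract a b" "degree a \<le> degree b"
    using assms(1) unfolding pole_order_le_def by blast
  obtain a' b' where y: "b' \<noteq> 0" "y * qq powi (- d) = Fract a' b'" "degree a' \<le> degree b'"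
    using assms(2) unfolding pole_order_le_def by blast
  have "(x + y) * qq powi (- d) = Fract (a * b' + a' * b) (b * b')"
    using x y by (simp add: distrib_right)
  moreover have "degree (a * b' + a' * b) \<le> degree (b * b')"
  proof -
    have "degree (a * b') \<le> degree b + degree b'" "degree (a' * b) \<le> degree b + degree b'"
      using x(3) y(3) degree_mult_le[of a b'] degree_mult_le[of a' b] by linarith+
    thus ?thesis using x(1) y(1) by (simp add: degree_mult_eq degree_add_le)
  qed
  ultimately show ?thesis using x(1) y(1) unfolding pole_order_le_def
    by (intro exI[of _ "a * b' + a' * b"] exI[of _ "b * b'"]) simp
qed

lemma pole_order_le_mult:
  assumes "pole_order_le d x" "pole_order_le e y"
  shows "pole_order_le (d + e) (x * y)"
proof -
  obtain a b where x: "b \<noteq> 0" "x * qq powi (- d) = Fract a b" "degree a \<le> degree b"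
    using assms(1) unfolding pole_order_le_def by blast
  obtain a' b' where y: "b' \<noteq> 0" "y * qq powi (- e) = Fract a' b'" "degree a' \<le> degree b'"
    using assms(2) unfolding pole_order_le_def by blast
  have "x * y * qq powi (- (d + e)) = (x * qq powi (- d)) * (y * qq powi (- e))"
    using power_int_add[of qq "- d" "- e"] by simp
  also have "\<dots> = Fract (a * a') (b * b')"
    using x y by simp
  finally have "x * y * qq powi (- (d + e)) = Fract (a * a') (b * b')" .
  moreover have "degree (a * a') \<le> degree (b * b')"
    using x y degree_mult_le[of a a'] by (simp add: degree_mult_eq)
  ultimately show ?thesis using x(1) y(1) unfolding pole_order_le_def
    by (intro exI[of _ "a * a'"] exI[of _ "b * b'"]) simp
qed

lemma pole_order_le_0 [simp]: "pole_order_le d 0"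
  unfolding pole_order_le_def
  by (intro exI[of _ 0] exI[of _ 1]) (simp add: Zero_fract_def)

lemma pole_order_le_of_int: "pole_order_le 0 (of_int i)"
  unfolding pole_order_le_def
  by (intro exI[of _ "[:of_int i:]"] exI[of _ 1]) (simp add: of_int_qf_eq_Fract)

lemma pole_order_le_qq_powi: "pole_order_le n (qq powi n)"
  using pole_order_le_of_int[of 1] unfolding pole_order_le_def
  by (simp flip: power_int_add)

lemma pole_order_le_mono:
  assumes "pole_order_le d x" "d \<le> e"
  shows "pole_order_le e x"
proof -
  have "qq powi (d - e) = inverse (qq ^ nat (e - d))"
    using assms(2) by (auto simp: power_int_def power_inverse)
  hence "qq powi (d - e) = Fract 1 (monom 1 (nat (e - d)))"
    by (simp add: qq_power)
  hence "pole_order_le 0 (qq powi (d - e))"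
    unfolding pole_order_le_def
    by (intro exI[of _ 1] exI[of _ "monom 1 (nat (e - d))"]) (simp add: degree_monom_eq monom_eq_0_iff)
  hence "pole_order_le (e - d) 1"
    unfolding pole_order_le_def by simp
  from pole_order_le_mult[OF this assms(1)] show ?thesis by simp
qed

lemma pole_order_le_uminus: "pole_order_le d x \<Longrightarrow> pole_order_le d (- x)"
  using pole_order_le_mult[OF pole_order_le_of_int[of "- 1"], of d x] by simp

lemma pole_order_le_diff: "pole_order_le d x \<Longrightarrow> pole_order_le d y \<Longrightarrow> pole_order_le d (x - y)"
  using pole_order_le_add[of d x "- y"] by (simp add: pole_order_le_uminus)

text \<open>Regularity at infinity of a/q^d bounds the degree of the polynomial a. For negative d no
  nonzero polynomial is left.\<close>

lemma pole_order_le_Fract_1: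
  assumes "pole_order_le d (Fract a 1)" "a \<noteq> 0"
  shows "int (degree a) \<le> d"
proof -
  obtain p b where pb: "b \<noteq> 0" "Fract a 1 * qq powi (- d) = Fract p b" "degree p \<le> degree b"
    using assms(1) unfolding pole_order_le_def by blast
  show ?thesis
  proof (cases "d \<ge> 0")
    case True
    have "Fract a 1 = Fract p b * qq powi d"
      using pb(2) by (simp add: power_int_minus field_simps flip: pb(2))
    also have "\<dots> = Fract (p * monom 1 (nat d)) b"
      using True by (simp add: power_int_def qq_power)
    finally have "a * b = p * monom 1 (nat d)"
      using pb(1) by (simp add: eq_fract)
    hence "degree (a * b) \<le> degree p + nat d"
      using degree_mult_le[of p "monom 1 (nat d)"] degree_monom_le[of "1::rat" "nat d"] by simp
    thus ?thesis using pb assms(2) True by (simp add: degree_mult_eq)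
  next
    case False
    hence "Fract (a * monom 1 (nat (- d))) 1 = Fract p b"
      using pb(2) by (simp add: power_int_def qq_power)
    hence "a * monom 1 (nat (- d)) * b = p"
      using pb(1) by (simp add: eq_fract)
    hence "degree a + nat (- d) + degree b \<le> degree b"
      using pb(1,3) assms(2)
      by (metis degree_monom_eq degree_mult_eq monom_eq_0_iff no_zero_divisors zero_neq_one)
    thus ?thesis using False by simp
  qed
qed

lemma in_qinvZqinv_pole_order:
  assumes "in_qinvZqinv x"
  shows "pole_order_le (- 1) x"
proof -
  have int: "pole_order_le 0 (ipoly p (inverse qq))" for p
  proof (induction p)
    case (pCons c p)
    have "pole_order_le (- 1) (inverse qq)"
      using pole_order_le_qq_powi[of "- 1"] by (simp add: power_int_minus)
    from pole_order_le_mult[OF this pCons.IH] show ?case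
      by (auto simp: ipoly_pCons intro!: pole_order_le_add pole_order_le_of_int
          elim: pole_order_le_mono)
  qed simp
  obtain p where p: "coeff p 0 = 0" "x = ipoly p (inverse qq)"
    using assms unfolding in_qinvZqinv_def by blast
  obtain r where "p = pCons 0 r" using p(1) by (cases p) auto
  hence x: "x = qq powi (- 1) * ipoly r (inverse qq)"
    using p(2) by (simp add: ipoly_pCons power_int_minus)
  show ?thesis unfolding x
    using pole_order_le_mult[OF pole_order_le_qq_powi[of "- 1"] int[of r]] by simp
qed

text \<open>Bar invariance turns a polynomial in 1/q into a polynomial in q. It also vanishes at q =
  infinity, hence is 0. This drives the uniqueness of canonical basis elements.\<close>

lemma bar_invariant_in_qinvZqinv_eq_0:
  assumes "in_qinvZqinv x" "fbar x = x"
  shows "x = 0"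
proof -
  obtain p where p: "x = ipoly p (inverse qq)"
    using assms(1) unfolding in_qinvZqinv_def by blast
  have "x = ipoly p qq"
    using assms(2) p by (simp add: fbar_ipoly fbar_inverse fbar_qq)
  hence x: "x = Fract (map_poly of_int p) 1" by (simp add: ipoly_qq)
  have "pole_order_le (- 1) (Fract (map_poly of_int p) 1)"
    using in_qinvZqinv_pole_order[OF assms(1)] x by simp
  hence "map_poly (of_int :: int \<Rightarrow> rat) p = 0"
    using pole_order_le_Fract_1 by fastforce
  thus ?thesis using x by (simp add: Zero_fract_def)
qed

lemma in_qinvZqinv_0 [simp]: "in_qinvZqinv 0"
  unfolding in_qinvZqinv_def by (intro exI[of _ 0]) simp

lemma in_qinvZqinv_diff:
  assumes "in_qinvZqinv x" "in_qinvZqinv y"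
  shows "in_qinvZqinv (x - y)"
proof -
  obtain p where p: "coeff p 0 = 0" "x = ipoly p (inverse qq)"
    using assms unfolding in_qinvZqinv_def by blast
  obtain r where r: "coeff r 0 = 0" "y = ipoly r (inverse qq)"
    using assms unfolding in_qinvZqinv_def by blast
  have "x - y = ipoly (p - r) (inverse qq)"
    using p r by (simp add: ipoly_def of_int_qf.map_poly_hom_diff)
  thus ?thesis using p r unfolding in_qinvZqinv_def by (intro exI[of _ "p - r"]) simp
qed

lemma in_qinvZqinv_sum: "(\<And>i. i \<in> S \<Longrightarrow> in_qinvZqinv (g i)) \<Longrightarrow> in_qinvZqinv (sum g S)"
proof (induction S rule: infinite_finite_induct)
  case (insert i S)
  have "in_qinvZqinv (g i - (0 - sum g S))"
    using insert by (intro in_qinvZqinv_diff) auto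
  thus ?case using insert by simp
qed auto

text \<open>Write x = p(q)/q^k. Order at most -1 at infinity forces deg p < k, so each monomial of p
  becomes a strictly negative power of q. Integrality and growth can therefore be proved
  separately.\<close>

lemma in_qinvZqinvI:
  assumes "inA x" "pole_order_le (- 1) x"
  shows "in_qinvZqinv x"
proof -
  obtain p k where p: "x = ipoly p qq / qq ^ k" using assms(1) unfolding inA_def by blast
  have "pole_order_le (- 1 + int k) (x * qq powi (int k))"
    by (intro pole_order_le_mult assms(2) pole_order_le_qq_powi)
  hence po: "pole_order_le (int k - 1) (Fract (map_poly of_int p) 1)"
    using p by (simp add: ipoly_qq)
  have inj: "degree (map_poly of_int p :: rat poly) = degree p"
    by (rule degree_map_poly) simp
  have deg: "degree p < k" if "p \<noteq> 0"
    using pole_order_le_Fract_1[OF po] that inj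
    by (metis (no_types, lifting) coeff_0 coeff_map_poly leading_coeff_0_iff of_int_0 of_int_0_eq_iff
        of_nat_less_iff zle_diff1_eq)
  have "x = (\<Sum>i\<le>degree p. of_int (coeff p i) * inverse qq ^ (k - i))"
  proof (cases "p = 0")
    case False
    have "x = (\<Sum>i\<le>degree p. of_int (coeff p i) * qq ^ i / qq ^ k)"
      using p by (simp add: ipoly_def poly_altdef coeff_map_poly sum_divide_distrib degree_map_poly)
    also have "\<dots> = (\<Sum>i\<le>degree p. of_int (coeff p i) * inverse qq ^ (k - i))"
      using deg[OF False] by (intro sum.cong) (auto simp: power_diff field_simps)
    finally show ?thesis .
  qed (use p in simp)
  also have "in_qinvZqinv \<dots>"
  proof (cases "p = 0")
    case False
    show ?thesis
    proof (intro in_qinvZqinv_sum, unfold in_qinvZqinv_def)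
      show "\<exists>r. coeff r 0 = 0 \<and> of_int (coeff p i) * inverse qq ^ (k - i) = ipoly r (inverse qq)"
        if "i \<in> {..degree p}" for i
        using that deg[OF False]
        by (intro exI[of _ "monom (coeff p i) (k - i)"]) (auto simp: ipoly_monom)
    qed
  qed simp
  finally show ?thesis .
qed

section \<open>Quantum integers and binomials\<close>

lemma qq_powi_eq_1_iff: "qq powi n = 1 \<longleftrightarrow> n = 0"
proof
  assume 1: "qq powi n = 1"
  have nat: "k = 0" if "qq ^ k = 1" for k
  proof -
    have "monom (1::rat) k = 1"
      using that by (simp add: qq_power One_fract_def eq_fract)
    thus "k = 0" by (metis degree_1 degree_monom_eq zero_neq_one)
  qed
  show "n = 0"
  proof (cases "n \<ge> 0")
    case True
    with 1 nat[of "nat n"] show ?thesis by (simp add: power_int_def)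
  next
    case False
    with 1 have "qq ^ nat (- n) = 1" by (simp add: power_int_def power_inverse)
    with nat False show ?thesis by fastforce
  qed
qed simp

lemma qq_diff_inverse_nonzero: "qq - inverse qq \<noteq> 0"
proof
  assume "qq - inverse qq = 0"
  hence "qq powi 2 = 1" by (simp add: power2_eq_square field_simps)
  thus False by (simp add: qq_powi_eq_1_iff del: power_int_numeral)
qed

lemma qint_mult_diff: "qint n * (qq - inverse qq) = qq powi n - qq powi (- n)"
  using qq_diff_inverse_nonzero by (simp add: qint_def)

lemma qint_0 [simp]: "qint 0 = 0"
  by (simp add: qint_def)

lemma qint_1 [simp]: "qint 1 = 1"
  using qq_diff_inverse_nonzero by (simp add: qint_def)

lemma qint_uminus: "qint (- n) = - qint n"
  by (simp add: qint_def diff_divide_distrib)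

lemma qint_eq_0_iff [simp]: "qint n = 0 \<longleftrightarrow> n = 0"
proof
  assume "qint n = 0"
  hence e: "qq powi n = qq powi (- n)"
    using qint_mult_diff[of n] by simp
  have "qq powi (n + n) = qq powi n * qq powi n"
    by (rule power_int_add) simp
  also have "\<dots> = qq powi (- n) * qq powi n"
    using e by (rule arg_cong)
  also have "\<dots> = 1"
    by (simp add: power_int_minus)
  finally have "qq powi (n + n) = 1" .
  thus "n = 0" by (simp add: qq_powi_eq_1_iff)
qed simp

lemma qint_add: "qint (m + n) = qq powi n * qint m + qq powi (- m) * qint n"
proof -
  have "qint (m + n) * (qq - inverse qq)
      = (qq powi n * qint m + qq powi (- m) * qint n) * (qq - inverse qq)"
    by (simp only: distrib_right mult.assoc qint_mult_diff)
      (simp add: algebra_simps flip: power_int_add)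
  thus ?thesis using qq_diff_inverse_nonzero by simp
qed

lemma qfact_Suc: "qfact (Suc n) = qfact n * qint (int n + 1)"
  by (simp add: qfact_def add.commute)

lemma qfact_0 [simp]: "qfact 0 = 1"
  by (simp add: qfact_def)

lemma qfact_nonzero [simp]: "qfact n \<noteq> 0"
  by (simp add: qfact_def)

text \<open>The bar-symmetric Gaussian binomial. An integer upper entry lets the recurrences hold
  without side conditions.\<close>

definition qbin :: "int \<Rightarrow> nat \<Rightarrow> qf" where
  "qbin m s = (\<Prod>i<s. qint (m - int i)) / qfact s"

lemma qbin_0 [simp]: "qbin m 0 = 1"
  by (simp add: qbin_def)

lemma qbin_Suc: "qint (int s + 1) * qbin m (Suc s) = qint (m - int s) * qbin m s"
  by (simp add: qbin_def qfact_Suc field_simps del: of_nat_Suc)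

lemma qbin_absorb: "qint (int s + 1) * qbin (m + 1) (Suc s) = qint (m + 1) * qbin m s"
  by (simp add: qbin_def qfact_Suc prod.lessThan_Suc_shift field_simps del: prod.lessThan_Suc)

text \<open>Absorption produces the factor [m+1]; splitting it as [(m-s)+(s+1)] by
  \<open>qint_add\<close> gives the two terms. Integrality of the binomials follows by
  induction.\<close>

lemma qbin_pascal:
  "qbin (m + 1) (Suc s) = qq powi (int s + 1) * qbin m (Suc s) + qq powi (int s - m) * qbin m s"
proof -
  have "qint (int s + 1) * qbin (m + 1) (Suc s) = qint ((m - int s) + (int s + 1)) * qbin m s"
    using qbin_absorb[of s m] by (simp add: algebra_simps)
  also have "\<dots> = qq powi (int s + 1) * (qint (m - int s) * qbin m s)
      + qq powi (int s - m) * qint (int s + 1) * qbin m s"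
    by (subst qint_add) (simp add: algebra_simps)
  also have "\<dots> = qint (int s + 1) *
      (qq powi (int s + 1) * qbin m (Suc s) + qq powi (int s - m) * qbin m s)"
    unfolding qbin_Suc[symmetric] by (simp add: algebra_simps)
  finally show ?thesis by (simp del: of_nat_Suc)
qed

lemma qbin_nat_0: "n < s \<Longrightarrow> qbin (int n) s = 0"
  by (auto simp: qbin_def intro!: prod_zero bexI[of _ n])

lemma inA_qbin: "inA (qbin (int n) s)"
proof (induction n arbitrary: s)
  case 0
  show ?case using qbin_nat_0[of 0 s] by (cases s) auto
next
  case (Suc n)
  show ?case
  proof (cases s)
    case (Suc k)
    show ?thesis unfolding Suc
      using qbin_pascal[of "int n" k] Suc.IH
      by (auto simp: add.commute intro!: inA_add inA_mult inA_qq_powi)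
  qed simp
qed

lemma qfact_add: "qfact (m + n) = qbin (int (m + n)) m * qfact m * qfact n"
proof (induction m)
  case (Suc m)
  have "qint (int m + 1) * qbin (int (m + n) + 1) (Suc m) = qint (int (m + n) + 1) * qbin (int (m + n)) m"
    by (rule qbin_absorb)
  thus ?case using Suc by (simp add: qfact_Suc algebra_simps)
qed simp

lemma pole_order_qint: "pole_order_le (int n) (qint (int n + 1))"
proof (induction n)
  case 0
  show ?case using pole_order_le_of_int[of 1] by simp
next
  case (Suc n)
  have "qint (int (Suc n) + 1) = qq powi 1 * qint (int n + 1) + qq powi (- (int n + 1)) * 1"
    using qint_add[of "int n + 1" 1] by (simp add: algebra_simps)
  also have "pole_order_le (int (Suc n)) \<dots>"
  proof (rule pole_order_le_add)
    show "pole_order_le (int (Suc n)) (qq powi 1 * qint (int n + 1))"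
      using pole_order_le_mult[OF pole_order_le_qq_powi[of 1] Suc] by (simp del: power_int_1_right)
    show "pole_order_le (int (Suc n)) (qq powi (- (int n + 1)) * 1)"
      using pole_order_le_mono[OF pole_order_le_qq_powi[of "- (int n + 1)"], of "int (Suc n)"] by simp
  qed
  finally show ?case .
qed

text \<open>The uniform bound includes n = 0, where the value 0 satisfies even the bound -1.\<close>

lemma pole_order_qint_abs: "pole_order_le (\<bar>n\<bar> - 1) (qint n)"
proof (cases n rule: int_cases3)
  case (pos k)
  then obtain j where "k = Suc j" by (cases k) auto
  thus ?thesis using pole_order_qint[of j] pos by (simp add: add.commute)
next
  case (neg k)
  then obtain j where "k = Suc j" by (cases k) auto
  hence n: "n = - (int j + 1)" using neg by simp
  show ?thesis unfolding n qint_uminus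
    using pole_order_le_uminus[OF pole_order_qint[of j]] by simp
qed simp

text \<open>Here 1/[n+1] = (q^2 - 1) q^n / (q^(2n+2) - 1), of degree -n. Division by [n+1] thus
  gains the full factor q^(-n).\<close>

lemma pole_order_inverse_qint: "pole_order_le (- int n) (inverse (qint (int n + 1)))"
proof -
  define m where "m = 2 * (n + 1)"
  have pw: "qq powi (int n + 1) = qq ^ (n + 1)" "qq powi (- (int n + 1)) = inverse (qq ^ (n + 1))"
    using power_int_of_nat[of qq "n + 1"] unfolding power_int_minus by (simp_all add: add.commute)
  have "qint (int n + 1) * ((qq ^ 2 - 1) * qq ^ n) = qint (int n + 1) * (qq - inverse qq) * qq ^ (n + 1)"
    by (simp add: power2_eq_square field_simps)
  also have "\<dots> = qq ^ m - 1"
    unfolding qint_mult_diff pw m_def mult_2 power_add by (simp add: field_simps)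
  finally have qm: "qint (int n + 1) * ((qq ^ 2 - 1) * qq ^ n) = qq ^ m - 1" .
  have "qq powi int m \<noteq> 1"
    unfolding qq_powi_eq_1_iff by (simp add: m_def)
  hence nz: "qq ^ m - 1 \<noteq> 0"
    by simp
  have e: "inverse (qint (int n + 1)) = (qq ^ 2 - 1) * qq ^ n / (qq ^ m - 1)"
  proof -
    have "(qq ^ 2 - 1) * qq ^ n \<noteq> 0" using qm nz by (metis mult_zero_right)
    thus ?thesis by (simp add: field_simps flip: qm)
  qed
  have c: "qq ^ k - 1 = Fract (monom 1 k - 1) 1" for k
    by (simp add: qq_power One_fract_def)
  have nz': "monom (1::rat) m - 1 \<noteq> 0"
    using nz unfolding c by (auto simp: Zero_fract_def)
  have "inverse (qint (int n + 1)) * qq powi (- (- int n))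
      = Fract ((monom 1 2 - 1) * monom 1 (2 * n)) (monom 1 m - 1)"
  proof -
    have "inverse (qint (int n + 1)) * qq powi (- (- int n)) = (qq ^ 2 - 1) * qq ^ (2 * n) / (qq ^ m - 1)"
      by (simp add: e mult_2 power_add)
    also have "\<dots> = Fract ((monom 1 2 - 1) * monom 1 (2 * n)) (monom 1 m - 1)"
      unfolding c using nz' by (simp add: qq_power)
    finally show ?thesis .
  qed
  moreover have "degree ((monom 1 2 - 1) * monom 1 (2 * n) :: rat poly) \<le> m"
  proof -
    have "degree (monom 1 2 - 1 :: rat poly) \<le> 2"
      by (intro degree_diff_le degree_monom_le) simp
    hence "degree (monom 1 2 - 1 :: rat poly) + degree (monom (1::rat) (2 * n)) \<le> 2 + 2 * n"
      by (rule add_mono) (rule degree_monom_le)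
    thus ?thesis
      unfolding m_def by (intro order_trans[OF degree_mult_le]) simp
  qed
  moreover have "m \<le> degree (monom 1 m - 1 :: rat poly)"
    by (rule le_degree) (auto simp: m_def)
  ultimately show ?thesis
    unfolding pole_order_le_def using nz' by (intro exI conjI) (assumption+, linarith)
qed

section \<open>The action of polynomials in t\<close>

lemma t_act_linear:
  "t_act \<kappa> mu (\<lambda>a. c * u a + w a) = (\<lambda>a. c * t_act \<kappa> mu u a + t_act \<kappa> mu w a)"
  by (rule ext) (simp add: t_act_def algebra_simps)

lemma t_act_zero: "t_act \<kappa> mu (\<lambda>a. 0) = (\<lambda>a. 0)"
  by (rule ext) (simp add: t_act_def)

text \<open>A common upper summation limit allows the actions of polynomials of different degrees to
  be added termwise.\<close>

lemma act_eq_sum: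
  assumes "degree p \<le> N"
  shows "act \<kappa> mu p v a = (\<Sum>i\<le>N. coeff p i * (t_act \<kappa> mu ^^ i) v a)"
  unfolding act_def using assms
  by (intro sum.mono_neutral_left) (auto simp: coeff_eq_0)

lemma act_0 [simp]: "act \<kappa> mu 0 v = (\<lambda>a. 0)"
  by (rule ext) (simp add: act_def)

lemma act_add: "act \<kappa> mu (p + r) v a = act \<kappa> mu p v a + act \<kappa> mu r v a"
proof -
  define N where "N = max (degree p) (degree r)"
  have "degree (p + r) \<le> N" unfolding N_def by (rule degree_add_le_max)
  moreover have "degree p \<le> N" "degree r \<le> N" unfolding N_def by auto
  ultimately show ?thesis
    by (simp add: act_eq_sum[of _ N] distrib_right sum.distrib)
qed

lemma act_smult: "act \<kappa> mu (smult c p) v a = c * act \<kappa> mu p v a"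
  by (simp add: act_eq_sum[of _ "degree p"] sum_distrib_left mult.assoc)

lemma act_diff: "act \<kappa> mu (p - r) v a = act \<kappa> mu p v a - act \<kappa> mu r v a"
  using act_add[of \<kappa> mu "p - r" r v a] by simp

lemma act_pCons: "act \<kappa> mu (pCons c p) v = (\<lambda>a. c * v a + act \<kappa> mu p (t_act \<kappa> mu v) a)"
proof
  fix a
  have "act \<kappa> mu (pCons c p) v a
      = (\<Sum>i\<le>Suc (degree p). coeff (pCons c p) i * (t_act \<kappa> mu ^^ i) v a)"
    by (rule act_eq_sum) (rule degree_pCons_le)
  also have "\<dots> = c * v a + act \<kappa> mu p (t_act \<kappa> mu v) a"
    unfolding sum.atMost_Suc_shift act_def
    by (simp add: funpow_Suc_right del: funpow.simps(2))
  finally show "act \<kappa> mu (pCons c p) v a = c * v a + act \<kappa> mu p (t_act \<kappa> mu v) a" .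
qed

lemma act_t_act: "act \<kappa> mu p (t_act \<kappa> mu v) = t_act \<kappa> mu (act \<kappa> mu p v)"
proof (induction p arbitrary: v)
  case (pCons c p)
  show ?case by (simp add: act_pCons t_act_linear pCons.IH)
qed (simp add: t_act_zero)

lemma act_mult: "act \<kappa> mu (p * r) v = act \<kappa> mu p (act \<kappa> mu r v)"
proof (induction p)
  case (pCons c p)
  show ?case
    by (rule ext) (simp add: act_add act_smult act_pCons act_t_act pCons.IH)
qed simp

lemma act_1 [simp]: "act \<kappa> mu 1 v = v"
  by (simp add: one_pCons act_pCons)

lemma act_linear_factor:
  "act \<kappa> mu ([:- c, 1:] * p) v = (\<lambda>a. t_act \<kappa> mu (act \<kappa> mu p v) a - c * act \<kappa> mu p v a)"
  by (simp only: act_mult act_pCons) simp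

lemma inL_vplus: "inL mu vplus"
  by (simp add: inL_def vplus_def)

lemma inL_act:
  assumes "inL mu v"
  shows "inL mu (act \<kappa> mu p v)"
  using assms
proof (induction p arbitrary: v)
  case (pCons c p)
  have "inL mu (t_act \<kappa> mu v)" by (simp add: inL_def t_act_def)
  with pCons show ?case by (simp add: act_pCons inL_def)
qed (simp add: inL_def)

section \<open>Shifted q-factorial polynomials\<close>

text \<open>The roots are the n consecutive even quantum integers going down from [2k]. For k = l +
  lam and n = 2 lam + 1 they are the eigenvalues of t on L(2 lam).\<close>

definition epoly :: "nat \<Rightarrow> int \<Rightarrow> qf poly" where
  "epoly n k = smult (inverse (qfact n)) (\<Prod>j<n. [:- qint (2 * (k - int j)), 1:])"

lemma epoly_0 [simp]: "epoly 0 k = 1"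
  by (simp add: epoly_def)

lemma qint_inverse_qfact_Suc: "qint (int n + 1) * inverse (qfact (Suc n)) = inverse (qfact n)"
  by (simp add: qfact_Suc field_simps)

lemma epoly_Suc:
  "smult (qint (int n + 1)) (epoly (Suc n) k) = [:- qint (2 * (k - int n)), 1:] * epoly n k"
  by (simp add: epoly_def qint_inverse_qfact_Suc mult.commute[of _ "[:_, _:]"]
      del: mult_pCons_left mult_pCons_right)

lemma epoly_Suc_shift:
  "smult (qint (int n + 1)) (epoly (Suc n) k) = [:- qint (2 * k), 1:] * epoly n (k - 1)"
  by (simp add: epoly_def qint_inverse_qfact_Suc prod.lessThan_Suc_shift diff_diff_add
      del: prod.lessThan_Suc mult_pCons_left mult_pCons_right)

text \<open>The gap between two roots is divisible by [m] with quotient in A, which makes the Pascal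
  identity below integral.\<close>

lemma qint_diff_even:
  "qint (2 * k) - qint (2 * (k - m)) = qint m * (qq powi (2 * k - m) + qq powi (m - 2 * k))"
proof -
  have "(qint (2 * k) - qint (2 * (k - m))) * (qq - inverse qq)
    = qint m * (qq - inverse qq) * (qq powi (2 * k - m) + qq powi (m - 2 * k))"
    by (simp only: left_diff_distrib qint_mult_diff)
      (simp add: algebra_simps flip: power_int_add)
  thus ?thesis using qq_diff_inverse_nonzero by simp
qed

text \<open>Both polynomials of degree n+1 extend \<open>epoly n (k - 1)\<close> by one root, [2k]
  above or [2(k-1-n)] below. The difference of these roots is a multiple of [n+1], which cancels
  against [n+1]!.\<close>

lemma epoly_pascal:
  "epoly (Suc n) k = epoly (Suc n) (k - 1)
    - smult (qq powi (2 * k - (int n + 1)) + qq powi ((int n + 1) - 2 * k)) (epoly n (k - 1))"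
proof -
  define c where "c = qq powi (2 * k - (int n + 1)) + qq powi ((int n + 1) - 2 * k)"
  have "qint (2 * k) - qint (2 * (k - 1 - int n)) = qint (int n + 1) * c"
    using qint_diff_even[of k "int n + 1"] by (simp add: c_def algebra_simps)
  hence q: "[:- qint (2 * k), 1:] = [:- qint (2 * (k - 1 - int n)), 1:] - [:qint (int n + 1) * c:]"
    by simp
  have "smult (qint (int n + 1)) (epoly (Suc n) k)
      = smult (qint (int n + 1)) (epoly (Suc n) (k - 1) - smult c (epoly n (k - 1)))"
    unfolding smult_diff_right epoly_Suc[of n "k - 1"] epoly_Suc_shift[of n k] q left_diff_distrib
    by simp
  moreover have "qint (int n + 1) \<noteq> 0" by simp
  ultimately show ?thesis unfolding c_def by (metis smult_cancel)
qed

text \<open>The two strings of roots are adjacent and concatenate; only the factorials have to be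
  compared.\<close>

lemma epoly_mult: "epoly m k * epoly n (k - int m) = smult (qbin (int (m + n)) m) (epoly (m + n) k)"
proof -
  have "(\<Prod>j<m + n. [:- qint (2 * (k - int j)), 1:])
     = (\<Prod>j<m. [:- qint (2 * (k - int j)), 1:]) * (\<Prod>j<n. [:- qint (2 * (k - int m - int j)), 1:])"
    by (induction n) (simp_all add: algebra_simps del: mult_pCons_left mult_pCons_right)
  moreover have "inverse (qfact m) * inverse (qfact n) = qbin (int (m + n)) m * inverse (qfact (m + n))"
    using qfact_nonzero[of "m + n"] unfolding qfact_add by (simp add: field_simps)
  ultimately show ?thesis
    by (simp add: epoly_def mult.commute del: of_nat_add)
qed

text \<open>The A-span of the \<open>epoly n k\<close>, built one term at a time, so that rule
  induction takes the place of finite sums.\<close>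

inductive_set Lam :: "int \<Rightarrow> qf poly set" for k where
  Lam_0: "0 \<in> Lam k"
| Lam_step: "f \<in> Lam k \<Longrightarrow> inA c \<Longrightarrow> smult c (epoly n k) + f \<in> Lam k"

lemma Lam_add: "f \<in> Lam k \<Longrightarrow> g \<in> Lam k \<Longrightarrow> f + g \<in> Lam k"
  by (induction rule: Lam.induct) (auto simp: add.assoc intro: Lam.intros)

lemma Lam_smult: "f \<in> Lam k \<Longrightarrow> inA c \<Longrightarrow> smult c f \<in> Lam k"
  by (induction rule: Lam.induct) (auto simp: smult_add_right intro: Lam.intros inA_mult)

lemma epoly_in_Lam: "epoly n k \<in> Lam k"
  using Lam_step[OF Lam_0 inA_1, of n k] by simp

lemma Lam_diff: "f \<in> Lam k \<Longrightarrow> g \<in> Lam k \<Longrightarrow> f - g \<in> Lam k"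
  using Lam_add[of f k "smult (- 1) g"] Lam_smult[of g k "- 1"] inA_uminus[of 1] by simp

lemma Lam_subsetI:
  assumes "\<And>n. epoly n k \<in> Lam m"
  shows "Lam k \<subseteq> Lam m"
proof
  fix f assume "f \<in> Lam k"
  thus "f \<in> Lam m"
    by (induction rule: Lam.induct) (auto intro: Lam_0 Lam_add Lam_smult assms)
qed

lemma inA_shift_coeff: "inA (qq powi m + qq powi n)"
  by (intro inA_add inA_qq_powi)

text \<open>The Pascal identity is a unitriangular change of generators over A. One inclusion reads
  it directly; the other solves it for \<open>epoly (Suc m) (k - 1)\<close> by induction on the
  degree.\<close>

lemma Lam_shift: "Lam k = Lam (k - 1)"
proof
  show "Lam k \<subseteq> Lam (k - 1)"
  proof (rule Lam_subsetI)
    show "epoly n k \<in> Lam (k - 1)" for n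
    proof (cases n)
      case 0
      then show ?thesis using epoly_in_Lam[of 0 "k - 1"] by simp
    next
      case (Suc m)
      show ?thesis unfolding Suc epoly_pascal[of m k]
        by (intro Lam_diff Lam_smult epoly_in_Lam inA_shift_coeff)
    qed
  qed
  show "Lam (k - 1) \<subseteq> Lam k"
  proof (rule Lam_subsetI)
    show "epoly n (k - 1) \<in> Lam k" for n
    proof (induction n)
      case 0
      then show ?case using epoly_in_Lam[of 0 k] by simp
    next
      case (Suc m)
      have "epoly (Suc m) (k - 1) = epoly (Suc m) k
          + smult (qq powi (2 * k - (int m + 1)) + qq powi ((int m + 1) - 2 * k)) (epoly m (k - 1))"
        using epoly_pascal[of m k] by simp
      also have "\<dots> \<in> Lam k"
        by (intro Lam_add Lam_smult epoly_in_Lam inA_shift_coeff Suc)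
      finally show ?case .
    qed
  qed
qed

lemma Lam_eq: "Lam k = Lam m"
proof -
  have "Lam k = Lam 0" for k
  proof (induction k rule: int_induct[where k = 0])
    case (step1 i)
    then show ?case using Lam_shift[of "i + 1"] by simp
  next
    case (step2 i)
    then show ?case using Lam_shift[of i] by simp
  qed simp
  thus ?thesis by metis
qed

lemma Lam_mult:
  assumes "f \<in> Lam k" "g \<in> Lam k"
  shows "f * g \<in> Lam k"
proof -
  have e: "epoly m k * h \<in> Lam k" if "h \<in> Lam k" for m h
  proof -
    \<comment> \<open>Re-expanding h with top root [2(k-m)] makes its generators adjacent to
      \<open>epoly m k\<close>, as \<open>epoly_mult\<close> requires.\<close>
    have "h \<in> Lam (k - int m)" using that Lam_eq by blast
    thus ?thesis
    proof (induction rule: Lam.induct)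
      case (Lam_step f c n)
      have "smult (c * qbin (int (m + n)) m) (epoly (m + n) k) \<in> Lam k"
        by (intro Lam_smult epoly_in_Lam inA_mult Lam_step inA_qbin)
      hence "epoly m k * smult c (epoly n (k - int m)) \<in> Lam k"
        by (simp add: epoly_mult)
      with Lam_step show ?case by (simp add: distrib_left Lam_add)
    qed (simp add: Lam_0)
  qed
  show ?thesis using assms(1)
    by (induction rule: Lam.induct)
      (auto simp: distrib_right intro!: Lam_0 Lam_add Lam_smult e assms(2))
qed

section \<open>The highest weight vector\<close>

lemma qint_mult_qint:
  "qint a * qint b * (qq - inverse qq)\<^sup>2
    = qq powi (a + b) - qq powi (a - b) - qq powi (b - a) + qq powi (- a - b)"
proof -
  have "qint a * qint b * (qq - inverse qq)\<^sup>2
      = (qint a * (qq - inverse qq)) * (qint b * (qq - inverse qq))"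
    by (simp add: power2_eq_square)
  thus ?thesis
    unfolding qint_mult_diff by (simp add: algebra_simps flip: power_int_add)
qed

lemma qint_exchange:
  "qint (r + s + 1) * qint (m - s) = qint r * qint (m + 1) + qint (s + 1) * qint (m - s - r)"
proof -
  have "qint (r + s + 1) * qint (m - s) * (qq - inverse qq)\<^sup>2
      = (qint r * qint (m + 1) + qint (s + 1) * qint (m - s - r)) * (qq - inverse qq)\<^sup>2"
    unfolding distrib_right qint_mult_qint
    by (simp add: algebra_simps) (rule arg_cong[where f = "\<lambda>i. qq powi i"], simp)
  thus ?thesis using qq_diff_inverse_nonzero by simp
qed

text \<open>The diagonal coefficient of t minus the next root. In \<open>ecoef_rec\<close> the first
  summand cancels the contribution of E, and the second joins that of F through
  \<open>qint_exchange\<close>.\<close>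

lemma qint_diagonal_term:
  "qint (2 * l) * qq powi (2 * r - m) - qint (2 * l + m - 2 * (r + s))
    = qq powi (s - 2 * l - m + 2 * r) * qint s - qq powi (2 * l - s) * qint (m - 2 * r - s)"
proof -
  have "(qint (2 * l) * (qq - inverse qq)) * qq powi (2 * r - m)
        - qint (2 * l + m - 2 * (r + s)) * (qq - inverse qq)
    = qq powi (s - 2 * l - m + 2 * r) * (qint s * (qq - inverse qq))
        - qq powi (2 * l - s) * (qint (m - 2 * r - s) * (qq - inverse qq))"
    unfolding qint_mult_diff by (simp add: algebra_simps flip: power_int_add)
  hence "(qint (2 * l) * qq powi (2 * r - m) - qint (2 * l + m - 2 * (r + s))) * (qq - inverse qq)
    = (qq powi (s - 2 * l - m + 2 * r) * qint s - qq powi (2 * l - s) * qint (m - 2 * r - s))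
        * (qq - inverse qq)"
    by (simp add: algebra_simps)
  thus ?thesis using qq_diff_inverse_nonzero by simp
qed

text \<open>In closed form (-1)^s q^(2ls - s(s-1)/2).\<close>

definition wcoef :: "int \<Rightarrow> nat \<Rightarrow> qf" where
  "wcoef l s = (\<Prod>i<s. - (qq powi (2 * l - int i)))"

lemma wcoef_0 [simp]: "wcoef l 0 = 1"
  by (simp add: wcoef_def)

lemma wcoef_Suc: "wcoef l (Suc s) = - (qq powi (2 * l - int s)) * wcoef l s"
  by (simp add: wcoef_def)

lemma inA_wcoef: "inA (wcoef l s)"
  by (induction s) (auto simp: wcoef_Suc intro: inA_mult inA_uminus inA_qq_powi)

text \<open>For mu = 2 lam these are the coordinates of \<open>epoly n (l + int lam)\<close> applied
  to the highest weight vector. The guard keeps \<open>n - r\<close> from truncating.\<close>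

definition ecoef :: "int \<Rightarrow> nat \<Rightarrow> nat \<Rightarrow> nat \<Rightarrow> qf" where
  "ecoef l mu n r = (if r \<le> n \<and> r \<le> mu then wcoef l (n - r) * qbin (int mu - int r) (n - r) else 0)"

text \<open>With s = n - r, all neighbouring coefficients become multiples of the single quantity
  \<open>X\<close> after multiplication by [s+1]. Fact \<open>A\<close> is the F part,
  \<open>B\<close> the E part, \<open>D\<close> the left-hand side.\<close>

lemma ecoef_rec:
  assumes r: "r \<le> mu"
  shows "qint (int n + 1) * ecoef l mu (Suc n) r
    = t_act (qint (2 * l)) mu (ecoef l mu n) r - qint (2 * l + int mu - 2 * int n) * ecoef l mu n r"
proof (cases "r \<le> n")
  case True
  define s where "s = n - r"
  define m where "m = int mu - int r"
  define X where "X = wcoef l s * qbin m s"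
  have n: "n = r + s" using True by (simp add: s_def)
  have X: "ecoef l mu n r = X" using r by (simp add: ecoef_def X_def s_def m_def True)
  have A: "qint (int s + 1) * (if r \<ge> 1 then qint (int r) * ecoef l mu n (r - 1) else 0)
      = - (qq powi (2 * l - int s)) * qint (int r) * qint (m + 1) * X"
  proof (cases r)
    case (Suc r')
    have "ecoef l mu n r' = wcoef l (Suc s) * qbin (m + 1) (Suc s)"
      using r by (simp add: ecoef_def n Suc m_def)
    hence "qint (int s + 1) * (qint (int r) * ecoef l mu n (r - 1))
        = qint (int r) * wcoef l (Suc s) * (qint (int s + 1) * qbin (m + 1) (Suc s))"
      by (simp add: Suc del: of_nat_Suc)
    thus ?thesis
      unfolding qbin_absorb by (simp add: Suc wcoef_Suc X_def del: of_nat_Suc)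
  qed simp
  have B: "(if r + 1 \<le> mu then qq powi (1 - int mu + 2 * int r) * qint (int mu - int r)
        * ecoef l mu n (r + 1) else 0)
      = - (qq powi (int s - 2 * l - int mu + 2 * int r)) * qint (int s) * X"
  proof (cases s)
    case 0
    then show ?thesis by (simp add: ecoef_def n)
  next
    case (Suc s')
    show ?thesis
    proof (cases "r + 1 \<le> mu")
      case True
      have pw: "qq powi (1 - int mu + 2 * int r)
          = qq powi (int s - 2 * l - int mu + 2 * int r) * qq powi (2 * l - int s')"
        by (simp add: Suc algebra_simps flip: power_int_add)
      have e: "ecoef l mu n (r + 1) = wcoef l s' * qbin (m - 1) s'"
        using True by (simp add: ecoef_def n Suc m_def diff_diff_add add.commute)
      have "qq powi (1 - int mu + 2 * int r) * qint m * ecoef l mu n (r + 1)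
          = qq powi (1 - int mu + 2 * int r) * wcoef l s' * (qint (m - 1 + 1) * qbin (m - 1) s')"
        unfolding e by simp
      also have "\<dots> = qq powi (1 - int mu + 2 * int r) * wcoef l s' * (qint (int s) * qbin m s)"
        unfolding qbin_absorb[symmetric] by (simp add: Suc add.commute)
      also have "\<dots> = - (qq powi (int s - 2 * l - int mu + 2 * int r)) * qint (int s) * X"
        unfolding pw by (simp add: X_def Suc wcoef_Suc)
      finally show ?thesis using True by (simp only: if_True m_def)
    next
      case False
      \<comment> \<open>At the lowest weight r = mu the E part is absent, and the right-hand side
        vanishes too because [0 choose s] = 0 for s > 0.\<close>
      hence "m = 0" using r by (simp add: m_def)
      thus ?thesis using False qbin_nat_0[of 0 s] by (simp add: X_def Suc)
    qed
  qed
  have D: "qint (int s + 1) * ecoef l mu (Suc n) r = - (qq powi (2 * l - int s)) * qint (m - int s) * X"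
  proof -
    have "ecoef l mu (Suc n) r = wcoef l (Suc s) * qbin m (Suc s)"
      using r by (simp add: ecoef_def n m_def)
    hence "qint (int s + 1) * ecoef l mu (Suc n) r = wcoef l (Suc s) * (qint (int s + 1) * qbin m (Suc s))"
      by simp
    thus ?thesis unfolding qbin_Suc by (simp add: wcoef_Suc X_def)
  qed
  have T: "t_act (qint (2 * l)) mu (ecoef l mu n) r - qint (2 * l + int mu - 2 * int n) * ecoef l mu n r
    = (if r \<ge> 1 then qint (int r) * ecoef l mu n (r - 1) else 0)
      + (if r + 1 \<le> mu then qq powi (1 - int mu + 2 * int r) * qint (int mu - int r)
           * ecoef l mu n (r + 1) else 0)
      + (qint (2 * l) * qq powi (2 * int r - int mu) - qint (2 * l + int mu - 2 * (int r + int s))) * X"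
    unfolding t_act_def X using r by (simp add: n algebra_simps)
  have "qint (int s + 1) * (t_act (qint (2 * l)) mu (ecoef l mu n) r
        - qint (2 * l + int mu - 2 * int n) * ecoef l mu n r)
      = - (qq powi (2 * l - int s)) * qint (int r) * qint (m + 1) * X
        + qint (int s + 1) * (- (qq powi (int s - 2 * l - int mu + 2 * int r)) * qint (int s) * X
        + (qq powi (int s - 2 * l - int mu + 2 * int r) * qint (int s)
            - qq powi (2 * l - int s) * qint (int mu - 2 * int r - int s)) * X)"
    unfolding T A[symmetric] B qint_diagonal_term by (simp only: distrib_left add.assoc)
  also have "\<dots> = - (qq powi (2 * l - int s)) * X
      * (qint (int r) * qint (m + 1) + qint (int s + 1) * qint (m - int s - int r))"
    by (simp add: m_def algebra_simps)
  also have "\<dots> = - (qq powi (2 * l - int s)) * X * (qint (int r + int s + 1) * qint (m - int s))"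
    unfolding qint_exchange ..
  also have "\<dots> = qint (int s + 1) * (qint (int n + 1) * ecoef l mu (Suc n) r)"
    unfolding mult.left_commute[of "qint (int s + 1)"] D by (simp add: n)
  finally show ?thesis by (simp del: of_nat_Suc)
next
  case False
  show ?thesis
  proof (cases "r = Suc n")
    case True
    then show ?thesis using r by (simp add: t_act_def ecoef_def add.commute)
  next
    case nr: False
    then show ?thesis using False r by (auto simp: t_act_def ecoef_def)
  qed
qed

text \<open>The even highest weight enters here: with mu = 2 lam, the next root [2(l + lam - n)] is
  the [2l + mu - 2n] of \<open>ecoef_rec\<close>.\<close>

lemma act_epoly:
  "act (qint (2 * l)) (2 * lam) (epoly n (l + int lam)) vplus = ecoef l (2 * lam) n"
proof (induction n)
  case 0
  show ?case by (auto simp: vplus_def ecoef_def fun_eq_iff)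
next
  case (Suc n)
  show ?case
  proof
    fix r
    have "qint (int n + 1) * act (qint (2 * l)) (2 * lam) (epoly (Suc n) (l + int lam)) vplus r
      = act (qint (2 * l)) (2 * lam) ([:- qint (2 * (l + int lam - int n)), 1:] * epoly n (l + int lam)) vplus r"
      unfolding act_smult[symmetric] epoly_Suc ..
    also have "\<dots> = t_act (qint (2 * l)) (2 * lam) (ecoef l (2 * lam) n) r
        - qint (2 * l + int (2 * lam) - 2 * int n) * ecoef l (2 * lam) n r"
      unfolding act_linear_factor Suc by (simp add: algebra_simps)
    also have "\<dots> = qint (int n + 1) * ecoef l (2 * lam) (Suc n) r"
    proof (cases "r \<le> 2 * lam")
      case True
      then show ?thesis by (rule ecoef_rec[symmetric])
    next
      case False
      then show ?thesis by (simp add: t_act_def ecoef_def)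
    qed
    finally show "act (qint (2 * l)) (2 * lam) (epoly (Suc n) (l + int lam)) vplus r
        = ecoef l (2 * lam) (Suc n) r"
      by (simp del: of_nat_Suc)
  qed
qed

lemma inA_ecoef: "inA (ecoef l mu n r)"
proof -
  have "inA (qbin (int mu - int r) (n - r))" if "r \<le> mu"
    using inA_qbin[of "mu - r" "n - r"] that by (simp add: of_nat_diff)
  thus ?thesis unfolding ecoef_def by (auto intro: inA_mult inA_wcoef)
qed

lemma ecoef_self: "n \<le> mu \<Longrightarrow> ecoef l mu n n = 1"
  by (simp add: ecoef_def)

lemma ecoef_above: "n < r \<Longrightarrow> ecoef l mu n r = 0"
  by (simp add: ecoef_def)

text \<open>The lower entry n - r exceeds the upper entry mu - r. So
  \<open>epoly (2 * lam + 1) (l + int lam)\<close> kills the highest weight vector.\<close>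

lemma ecoef_vanish:
  assumes "mu < n"
  shows "ecoef l mu n = (\<lambda>r. 0)"
proof
  fix r
  have "qbin (int mu - int r) (n - r) = 0" if "r \<le> mu"
    using qbin_nat_0[of "mu - r" "n - r"] that assms by (simp add: of_nat_diff diff_less_mono)
  thus "ecoef l mu n r = 0" by (simp add: ecoef_def)
qed

section \<open>Triangularity of the action on the highest weight vector and the integral
  lattice\<close>

lemma funpow_t_act_vplus_above: "i < r \<Longrightarrow> (t_act \<kappa> mu ^^ i) vplus r = 0"
proof (induction i arbitrary: r)
  case 0
  then show ?case by (simp add: vplus_def)
next
  case (Suc i)
  then show ?case by (simp add: t_act_def)
qed

lemma funpow_t_act_vplus_top: "i \<le> mu \<Longrightarrow> (t_act \<kappa> mu ^^ i) vplus i = qfact i"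
proof (induction i)
  case 0
  then show ?case by (simp add: vplus_def)
next
  case (Suc i)
  then show ?case
    by (simp add: t_act_def[of _ _ "(t_act \<kappa> mu ^^ i) vplus"] qfact_Suc funpow_t_act_vplus_above
        mult.commute add.commute)
qed

text \<open>Each t raises the index by at most one, so only t^r reaches coordinate r, and does so
  with coefficient [r]!. Leading coefficients can thus be read off from vectors.\<close>

lemma act_vplus_top:
  assumes "degree p \<le> r" "r \<le> mu"
  shows "act \<kappa> mu p vplus r = coeff p r * qfact r"
proof -
  have "act \<kappa> mu p vplus r = (\<Sum>i\<le>r. coeff p i * (t_act \<kappa> mu ^^ i) vplus r)"
    by (rule act_eq_sum) fact
  also have "\<dots> = coeff p r * (t_act \<kappa> mu ^^ r) vplus r"
    by (subst sum.remove[of _ r]) (auto intro!: sum.neutral simp: funpow_t_act_vplus_above)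
  finally show ?thesis using assms(2) by (simp add: funpow_t_act_vplus_top)
qed

lemma epoly_degree: "degree (epoly n k) = n"
  and epoly_lead: "coeff (epoly n k) n = inverse (qfact n)"
proof -
  define P where "P = (\<Prod>j<n. [:- qint (2 * (k - int j)), 1:])"
  have deg: "degree P = n"
    unfolding P_def by (subst degree_prod_eq_sum_degree) auto
  have "lead_coeff P = 1" unfolding P_def by (simp add: lead_coeff_prod)
  thus "degree (epoly n k) = n" "coeff (epoly n k) n = inverse (qfact n)"
    using deg unfolding epoly_def P_def[symmetric] by simp_all
qed

text \<open>Elimination from the top: \<open>epoly m\<close> yields a vector with top coordinate 1
  at m and entries in A. Surjectivity, the degree bound and integrality come from the same
  construction.\<close>

lemma act_vplus_onto:
  assumes "m \<le> 2 * lam + 1" "\<forall>r\<ge>m. v r = 0"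
  shows "\<exists>f. act (qint (2 * l)) (2 * lam) f vplus = v \<and> (\<forall>i\<ge>m. coeff f i = 0)
    \<and> ((\<forall>r. inA (v r)) \<longrightarrow> f \<in> Lam (l + int lam))"
  using assms
proof (induction m arbitrary: v)
  case 0
  then have "v = (\<lambda>r. 0)" by auto
  thus ?case by (intro exI[of _ 0]) (auto intro: Lam_0)
next
  case (Suc m)
  define v' where "v' = (\<lambda>r. v r - v m * ecoef l (2 * lam) m r)"
  have "v' r = 0" if "r \<ge> m" for r
    using that Suc.prems by (cases "r = m") (auto simp: v'_def ecoef_self ecoef_above)
  then obtain f where f: "act (qint (2 * l)) (2 * lam) f vplus = v'" "\<forall>i\<ge>m. coeff f i = 0"
      "(\<forall>r. inA (v' r)) \<longrightarrow> f \<in> Lam (l + int lam)"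
    using Suc.IH[of v'] Suc.prems by auto
  define g where "g = smult (v m) (epoly m (l + int lam)) + f"
  have "act (qint (2 * l)) (2 * lam) g vplus = v"
    by (rule ext) (simp add: g_def act_add act_smult act_epoly f(1) v'_def)
  moreover have "\<forall>i\<ge>Suc m. coeff g i = 0"
    using f(2) by (auto simp: g_def coeff_eq_0 epoly_degree)
  moreover have "g \<in> Lam (l + int lam)" if A: "\<forall>r. inA (v r)"
  proof -
    have "\<forall>r. inA (v' r)"
      using A by (auto simp: v'_def intro: inA_diff inA_mult inA_ecoef)
    thus ?thesis using f(3) A unfolding g_def by (auto intro: Lam_step)
  qed
  ultimately show ?case by blast
qed

lemma inLA_act_Lam:
  assumes "f \<in> Lam (l + int lam)"
  shows "inLA (2 * lam) (act (qint (2 * l)) (2 * lam) f vplus)"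
proof -
  have "inA (act (qint (2 * l)) (2 * lam) f vplus r)" for r
    using assms by (induction rule: Lam.induct)
      (auto simp: act_add act_smult act_epoly intro: inA_add inA_mult inA_ecoef)
  thus ?thesis by (auto simp: inLA_def intro: inL_act inL_vplus)
qed

text \<open>A lattice vector is g applied to the highest weight vector with g in \<open>Lam\<close>,
  and f * g stays in that ring. Independence of k lets one f serve all lam.\<close>

lemma Lam_subset_AUev: "Lam k \<subseteq> AUev (qint (2 * l))"
proof
  fix f assume "f \<in> Lam k"
  hence f: "f \<in> Lam (l + int lam)" for lam using Lam_eq by blast
  show "f \<in> AUev (qint (2 * l))"
    unfolding AUev_def
  proof (intro CollectI allI impI)
    fix lam v assume v: "inLA (2 * lam) v"
    then obtain g where g: "act (qint (2 * l)) (2 * lam) g vplus = v" "g \<in> Lam (l + int lam)"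
      using act_vplus_onto[of "2 * lam + 1" lam v l] by (auto simp: inLA_def inL_def)
    have "f * g \<in> Lam (l + int lam)" using f g(2) by (rule Lam_mult)
    from inLA_act_Lam[OF this] show "inLA (2 * lam) (act (qint (2 * l)) (2 * lam) f v)"
      by (simp add: act_mult g(1))
  qed
qed

section \<open>The bar involution and uniqueness of the canonical basis\<close>

lemma ipsiU_epoly: "ipsiU (epoly n k) = epoly n k"
  by (simp add: ipsiU_def epoly_def fbar.map_poly_hom_smult fbar.map_poly_hom_prod
      fbar.map_poly_hom_pCons fbar_inverse fbar_qfact fbar_qint fbar.hom_uminus fbar.hom_one)

text \<open>The annihilator of the highest weight vector is the ideal generated by \<open>e\<close>,
  which the bar involution fixes.\<close>

lemma ipsiU_kernel:
  assumes "act (qint (2 * l)) (2 * lam) p vplus = (\<lambda>r. 0)"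
  shows "act (qint (2 * l)) (2 * lam) (ipsiU p) vplus = (\<lambda>r. 0)"
proof -
  define e where "e = epoly (2 * lam + 1) (l + int lam)"
  have e0: "act (qint (2 * l)) (2 * lam) (h * e) vplus = (\<lambda>r. 0)" for h
  proof -
    have "act (qint (2 * l)) (2 * lam) e vplus = act (qint (2 * l)) (2 * lam) 0 vplus"
      unfolding e_def act_epoly by (simp add: ecoef_vanish)
    hence "act (qint (2 * l)) (2 * lam) (h * e) vplus = act (qint (2 * l)) (2 * lam) (h * 0) vplus"
      unfolding act_mult by simp
    thus ?thesis by simp
  qed
  have ne: "e \<noteq> 0" using epoly_degree[of "2 * lam + 1" "l + int lam"] by (auto simp: e_def)
  define g where "g = p mod e"
  have p: "p = (p div e) * e + g" by (simp add: g_def)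
  have g0: "act (qint (2 * l)) (2 * lam) g vplus r = 0" for r
    using assms act_add[of "qint (2 * l)" "2 * lam" "(p div e) * e" g vplus r]
    by (simp add: e0 flip: p)
  \<comment> \<open>A nonzero remainder has degree at most 2 lam, so its leading coefficient would
    show up as a nonzero coordinate.\<close>
  have "g = 0"
  proof (rule ccontr)
    assume "g \<noteq> 0"
    hence "degree g < 2 * lam + 1"
      using degree_mod_less[OF ne, of p] by (simp add: g_def e_def epoly_degree)
    hence "lead_coeff g * qfact (degree g) = 0"
      using g0[of "degree g"] by (simp add: act_vplus_top)
    thus False using \<open>g \<noteq> 0\<close> by simp
  qed
  hence "p = (p div e) * e" using p by simp
  hence "ipsiU p = ipsiU (p div e) * e"
    by (metis e_def ipsiU_def ipsiU_epoly fbar.map_poly_hom_mult)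
  thus ?thesis by (simp add: e0)
qed

lemma ipsiU_act_cong:
  assumes "act (qint (2 * l)) (2 * lam) p vplus = act (qint (2 * l)) (2 * lam) p' vplus"
  shows "act (qint (2 * l)) (2 * lam) (ipsiU p) vplus = act (qint (2 * l)) (2 * lam) (ipsiU p') vplus"
proof -
  have "act (qint (2 * l)) (2 * lam) (p - p') vplus = (\<lambda>r. 0)"
    by (rule ext) (simp add: act_diff assms)
  from ipsiU_kernel[OF this] show ?thesis
    by (simp add: ipsiU_def fbar.map_poly_hom_diff act_diff fun_eq_iff)
qed

text \<open>All polynomials representing the same vector have the same image after bar, so the
  choice inside \<open>ipsiL\<close> can be replaced by p.\<close>

lemma ipsiL_act:
  "ipsiL (qint (2 * l)) (2 * lam) (act (qint (2 * l)) (2 * lam) p vplus)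
    = act (qint (2 * l)) (2 * lam) (ipsiU p) vplus"
  unfolding ipsiL_def by (rule ipsiU_act_cong) (rule someI, rule refl)

text \<open>The difference w of two candidates is bar invariant with all coordinates in
  q^(-1)Z[q^(-1)]. Its top nonzero coordinate is itself fixed by \<open>fbar\<close>, hence 0, a
  contradiction.\<close>

lemma is_icb_unique:
  assumes "is_icb (qint (2 * l)) (2 * lam) a b" "is_icb (qint (2 * l)) (2 * lam) a b'"
  shows "b = b'"
proof (rule ccontr)
  let ?act = "\<lambda>p. act (qint (2 * l)) (2 * lam) p vplus"
  assume "b \<noteq> b'"
  define w where "w = (\<lambda>r. b r - b' r)"
  have onto: "\<exists>f. ?act f = v" if "inL (2 * lam) v" for v
    using act_vplus_onto[of "2 * lam + 1" lam v l] that by (auto simp: inL_def)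
  obtain f f' where f: "?act f = b" "?act f' = b'"
    using onto assms unfolding is_icb_def by metis
  have bar: "?act (ipsiU f) = b" "?act (ipsiU f') = b'"
    using assms f ipsiL_act[of l lam f] ipsiL_act[of l lam f'] by (auto simp: is_icb_def)
  have w: "?act (f - f') = w" "?act (ipsiU (f - f')) = w"
    using f bar by (auto simp: w_def act_diff ipsiU_def fbar.map_poly_hom_diff)
  have wL: "w r = 0" if "r \<ge> a \<or> r > 2 * lam" for r
    using assms that unfolding is_icb_def inL_def w_def by (cases "r = a") auto
  have wq: "in_qinvZqinv (w r)" for r
  proof (cases "r < a")
    case True
    then show ?thesis using assms unfolding is_icb_def w_def by (auto intro: in_qinvZqinv_diff)
  next
    case False
    then show ?thesis using wL by simp
  qed
  define S where "S = {r. w r \<noteq> 0}"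
  have S: "finite S" "S \<noteq> {}"
  proof -
    have "S \<subseteq> {..2 * lam}" unfolding S_def using wL by (force simp: not_le)
    thus "finite S" by (rule finite_subset) simp
    show "S \<noteq> {}" using \<open>b \<noteq> b'\<close> by (auto simp: S_def w_def)
  qed
  define r where "r = Max S"
  have "r \<in> S" unfolding r_def using S by simp
  hence r: "w r \<noteq> 0" "r \<le> 2 * lam" using wL[of r] by (simp add: S_def, metis S_def mem_Collect_eq not_le)
  have above: "\<forall>i\<ge>Suc r. w i = 0"
    using Max_ge[OF S(1)] unfolding r_def S_def by force
  \<comment> \<open>A representative of degree at most r is chosen because then both h and its bar
    image show their r-th coefficient, times [r]!, as \<open>w r\<close>.\<close>
  obtain h where h: "?act h = w" "\<forall>i\<ge>Suc r. coeff h i = 0"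
    using act_vplus_onto[of "Suc r" lam w l] above r(2) by auto
  have "?act (ipsiU h) = w"
    using ipsiU_act_cong[of l lam h "f - f'"] h(1) w by simp
  moreover have "degree h \<le> r" "degree (ipsiU h) \<le> r"
    using h(2) by (auto intro!: degree_le simp: ipsiU_def coeff_map_poly fbar.hom_zero)
  ultimately have "w r = coeff h r * qfact r" "w r = coeff (ipsiU h) r * qfact r"
    using act_vplus_top[of h r "2 * lam" "qint (2 * l)"]
      act_vplus_top[of "ipsiU h" r "2 * lam" "qint (2 * l)"] r(2) h(1)
    by simp_all
  hence "w r = coeff h r * qfact r" "w r = fbar (coeff h r) * qfact r"
    by (simp_all add: ipsiU_def coeff_map_poly fbar.hom_zero)
  hence "fbar (w r) = w r" by (metis fbar.hom_mult fbar_qfact)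
  thus False using bar_invariant_in_qinvZqinv_eq_0[OF wq] r(1) by blast
qed

section \<open>The divided powers\<close>

lemma prod_interval_eq_epoly:
  "smult (inverse (qfact n)) (\<Prod>j\<in>{k - int n + 1..k}. [:0, 1:] - [:qint (2 * j):]) = epoly n k"
proof -
  have "(\<Prod>j\<in>{k - int n + 1..k}. [:0, 1:] - [:qint (2 * j):])
      = (\<Prod>j<n. [:- qint (2 * (k - int j)), 1:])"
    by (rule prod.reindex_bij_witness[of _ "\<lambda>j. k - int j" "\<lambda>j. nat (k - j)"]) auto
  thus ?thesis by (simp add: epoly_def)
qed

lemma dot_t_0: "dot_t 0 = 1"
  by (simp add: dot_t_def)

lemma dot_t_odd: "dot_t (Suc (2 * a)) = epoly (Suc (2 * a)) (int a)"
  using prod_interval_eq_epoly[of "Suc (2 * a)" "int a"] by (simp add: dot_t_def Let_def)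

lemma dot_t_even_qint:
  "smult (qint (int (Suc (2 * a)) + 1)) (dot_t (Suc (Suc (2 * a)))) = [:0, 1:] * dot_t (Suc (2 * a))"
proof -
  have "dot_t (Suc (Suc (2 * a))) = smult (inverse (qfact (Suc (Suc (2 * a)))))
      ([:0, 1:] * (\<Prod>j\<in>{- int a..int a}. [:0, 1:] - [:qint (2 * j):]))"
    by (simp add: dot_t_def Let_def)
  hence "smult (qint (int (Suc (2 * a)) + 1)) (dot_t (Suc (Suc (2 * a))))
      = smult (inverse (qfact (Suc (2 * a))))
      ([:0, 1:] * (\<Prod>j\<in>{- int a..int a}. [:0, 1:] - [:qint (2 * j):]))"
    by (simp only: smult_smult qint_inverse_qfact_Suc)
  also have "\<dots> = [:0, 1:] * epoly (Suc (2 * a)) (int a)"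
    using prod_interval_eq_epoly[of "Suc (2 * a)" "int a"] by simp
  finally show ?thesis by (simp only: dot_t_odd)
qed

text \<open>Write t = (t - [2a+2]) + [2a+2] in the recursion from the odd power. The first part
  extends the root string upwards; in the second, [2a+2] cancels.\<close>

lemma dot_t_even:
  "dot_t (Suc (Suc (2 * a))) = epoly (Suc (Suc (2 * a))) (int a + 1) + dot_t (Suc (2 * a))"
proof -
  let ?c = "qint (int (Suc (2 * a)) + 1)"
  have c: "qint (2 * (int a + 1)) = ?c" by (simp add: algebra_simps)
  have "smult ?c (epoly (Suc (Suc (2 * a))) (int a + 1))
      = [:- ?c, 1:] * dot_t (Suc (2 * a))"
    using epoly_Suc_shift[of "Suc (2 * a)" "int a + 1"] unfolding c dot_t_odd by simp
  hence "smult ?c (epoly (Suc (Suc (2 * a))) (int a + 1) + dot_t (Suc (2 * a)))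
      = smult ?c (dot_t (Suc (Suc (2 * a))))"
    unfolding dot_t_even_qint by (simp add: smult_add_right)
  moreover have "?c \<noteq> 0" by simp
  ultimately show ?thesis by (metis smult_cancel)
qed

lemma dot_t_rec:
  "smult (qint (int n + 1)) (dot_t (Suc n))
    = [:0, 1:] * dot_t n - (if even n then smult (qint (int n)) (dot_t (n - 1)) else 0)"
proof (cases n rule: nat.exhaust)
  case zero
  \<comment> \<open>For n = 0 the truncated index \<open>n - 1\<close> is harmless: the subtracted
    term carries the factor [0].\<close>
  have "dot_t (Suc (2 * 0)) = [:0, 1:]" unfolding dot_t_odd by (simp add: epoly_def qfact_def)
  then show ?thesis using zero by (simp add: dot_t_0)
next
  case (Suc m)
  show ?thesis
  proof (cases "even n")
    case False
    then obtain a where "n = Suc (2 * a)" by (metis oddE Suc_eq_plus1)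
    then show ?thesis using dot_t_even_qint[of a] by simp
  next
    case True
    then obtain a where n: "n = Suc (Suc (2 * a))"
      using Suc by (metis evenE even_Suc oddE Suc_eq_plus1)
    let ?c = "qint (int (Suc (2 * a)) + 1)"
    \<comment> \<open>The odd power of index n+1 has the additional lowest root -[n], where n =
      2a+2; this produces the factor t + [n].\<close>
    have "qint (2 * (int a + 1 - int n)) = qint (- (int (Suc (2 * a)) + 1))"
      unfolding n by (simp add: algebra_simps)
    hence c: "qint (2 * (int a + 1 - int n)) = - ?c" by (simp only: qint_uminus)
    have "dot_t (Suc n) = epoly (Suc n) (int a + 1)"
      using dot_t_odd[of "Suc a"] by (simp add: n add.commute)
    hence "smult (qint (int n + 1)) (dot_t (Suc n)) = [:?c, 1:] * epoly n (int a + 1)"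
      using epoly_Suc[of n "int a + 1"] unfolding c by simp
    also have "\<dots> = [:?c, 1:] * (dot_t n - dot_t (Suc (2 * a)))"
      using dot_t_even[of a] by (simp add: n)
    also have "\<dots> = [:0, 1:] * dot_t n + smult ?c (dot_t n)
        - ([:0, 1:] * dot_t (Suc (2 * a)) + smult ?c (dot_t (Suc (2 * a))))"
      by (simp add: algebra_simps smult_diff_right)
    also have "\<dots> = [:0, 1:] * dot_t n - smult ?c (dot_t (Suc (2 * a)))"
      unfolding n dot_t_even_qint by simp
    finally show ?thesis using True by (simp add: n add.commute)
  qed
qed

section \<open>Integrality, bar invariance and growth of the divided powers\<close>

lemma dot_t_cases:
  obtains "n = 0" | a where "n = Suc (2 * a)" | a where "n = Suc (Suc (2 * a))"
  by (metis evenE even_Suc oddE Suc_eq_plus1 not0_implies_Suc)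

lemma dot_t_in_Lam: "dot_t n \<in> Lam k"
proof -
  have e: "epoly m i \<in> Lam k" for m i
    using epoly_in_Lam Lam_eq by blast
  show ?thesis
    by (cases n rule: dot_t_cases)
      (use e[of 0 0] in \<open>auto simp: dot_t_0 dot_t_even dot_t_odd intro: Lam_add e\<close>)
qed

lemma ipsiU_dot_t: "ipsiU (dot_t n) = dot_t n"
  by (cases n rule: dot_t_cases)
    (use ipsiU_epoly ipsiU_epoly[of 0 0] in
      \<open>auto simp: dot_t_0 dot_t_even dot_t_odd ipsiU_def fbar.map_poly_hom_add\<close>)

lemma dot_t_above: "n < i \<Longrightarrow> coeff (dot_t n) i = 0"
  and dot_t_lead: "coeff (dot_t n) n = inverse (qfact n)"
  by (cases n rule: dot_t_cases;
      auto simp: dot_t_0 dot_t_even dot_t_odd epoly_lead coeff_eq_0 epoly_degree)+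

lemma act_dot_t_above:
  assumes "n < r"
  shows "act \<kappa> mu (dot_t n) vplus r = 0"
proof -
  have "degree (dot_t n) \<le> n" using dot_t_above by (intro degree_le) blast
  thus ?thesis using assms
    by (simp add: act_eq_sum[of _ n] funpow_t_act_vplus_above)
qed

lemma act_dot_t_top:
  assumes "n \<le> mu"
  shows "act \<kappa> mu (dot_t n) vplus n = 1"
proof -
  have "degree (dot_t n) \<le> n" using dot_t_above by (intro degree_le) blast
  thus ?thesis using assms by (simp add: act_vplus_top dot_t_lead)
qed

lemma act_dot_t_rec:
  "qint (int n + 1) * act \<kappa> mu (dot_t (Suc n)) v r
    = t_act \<kappa> mu (act \<kappa> mu (dot_t n) v) r
      - (if even n then qint (int n) * act \<kappa> mu (dot_t (n - 1)) v r else 0)"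
proof -
  have "act \<kappa> mu ([:0, 1:] * dot_t n) v r = t_act \<kappa> mu (act \<kappa> mu (dot_t n) v) r"
    using act_linear_factor[of \<kappa> mu 0 "dot_t n" v] by simp
  thus ?thesis
    unfolding act_smult[symmetric] dot_t_rec act_diff
    by (simp only: act_smult act_0 split: if_split) auto
qed

text \<open>Strong induction along the three-term recursion: every term of [n+1] times the new
  coordinate is O(q^(n-1)), and dividing by [n+1] leaves O(q^(-1)).\<close>

lemma act_dot_t_pole_order:
  assumes "2 * \<bar>l\<bar> + int n \<le> int mu" "r < n"
  shows "pole_order_le (- 1) (act (qint (2 * l)) mu (dot_t n) vplus r)"
  using assms
proof (induction n arbitrary: r rule: less_induct)
  case (less n')
  then obtain n where n': "n' = Suc n" by (cases n') auto
  define D where "D = (\<lambda>m. act (qint (2 * l)) mu (dot_t m) vplus)"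
  have mu: "2 * \<bar>l\<bar> + int n + 1 \<le> int mu" and r: "r \<le> n"
    using less.prems n' by auto
  have off: "pole_order_le (- 1) (D m i)" if "m \<le> n" "i \<noteq> m" for m i
  proof (cases "i < m")
    case True
    have "pole_order_le (- 1) (act (qint (2 * l)) mu (dot_t m) vplus i)"
      by (rule less.IH) (use True that mu n' in auto)
    then show ?thesis by (simp add: D_def)
  next
    case False
    then show ?thesis using that by (simp add: D_def act_dot_t_above)
  qed
  have all: "pole_order_le 0 (D m i)" if "m \<le> n" for m i
  proof (cases "i = m")
    case True
    then show ?thesis using that mu pole_order_le_of_int[of 1] by (simp add: D_def act_dot_t_top)
  next
    case False
    then show ?thesis using off[OF that] pole_order_le_mono by fastforce
  qed
  have T1: "pole_order_le (int n - 1) (if r \<ge> 1 then qint (int r) * D n (r - 1) else 0)"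
  proof (cases "r \<ge> 1")
    case True
    have "pole_order_le ((\<bar>int r\<bar> - 1) + - 1) (qint (int r) * D n (r - 1))"
      using True r by (intro pole_order_le_mult pole_order_qint_abs off) auto
    then show ?thesis using True r by (auto elim!: pole_order_le_mono)
  qed simp
  \<comment> \<open>The two quantum factors together have order r, and coordinate r + 1 of
    \<open>D n\<close> vanishes unless r < n.\<close>
  have T2: "pole_order_le (int n - 1)
      (if r + 1 \<le> mu then qq powi (1 - int mu + 2 * int r) * qint (int mu - int r) * D n (r + 1) else 0)"
  proof (cases "r + 1 \<le> mu \<and> r < n")
    case True
    have "pole_order_le ((1 - int mu + 2 * int r) + (\<bar>int mu - int r\<bar> - 1) + 0)
        (qq powi (1 - int mu + 2 * int r) * qint (int mu - int r) * D n (r + 1))"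
      by (intro pole_order_le_mult pole_order_le_qq_powi pole_order_qint_abs all) simp
    moreover have "(1 - int mu + 2 * int r) + (\<bar>int mu - int r\<bar> - 1) + 0 \<le> int n - 1"
      using True by auto
    ultimately show ?thesis using True by (auto elim!: pole_order_le_mono)
  next
    case False
    then show ?thesis using r by (auto simp: D_def act_dot_t_above)
  qed
  \<comment> \<open>The size of mu relative to l is used here: 2|l| - 1 - mu + 2r is at most n -
    2.\<close>
  have T3: "pole_order_le (int n - 1) (qint (2 * l) * qq powi (- (int mu - 2 * int r)) * D n r)"
  proof -
    have "pole_order_le ((\<bar>2 * l\<bar> - 1) + (- (int mu - 2 * int r)) + 0)
        (qint (2 * l) * qq powi (- (int mu - 2 * int r)) * D n r)"
      by (intro pole_order_le_mult pole_order_le_qq_powi pole_order_qint_abs all) simp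
    moreover have "(\<bar>2 * l\<bar> - 1) + (- (int mu - 2 * int r)) + 0 \<le> int n - 1"
      using mu r by (simp add: abs_mult)
    ultimately show ?thesis by (rule pole_order_le_mono)
  qed
  have T4: "pole_order_le (int n - 1) (if even n then qint (int n) * D (n - 1) r else 0)"
  proof -
    have "pole_order_le ((\<bar>int n\<bar> - 1) + 0) (qint (int n) * D (n - 1) r)"
      by (intro pole_order_le_mult pole_order_qint_abs all) simp
    thus ?thesis by simp
  qed
  have "qint (int n + 1) * D (Suc n) r
      = (if r \<ge> 1 then qint (int r) * D n (r - 1) else 0)
      + (if r + 1 \<le> mu then qq powi (1 - int mu + 2 * int r) * qint (int mu - int r) * D n (r + 1) else 0)
      + qint (2 * l) * qq powi (- (int mu - 2 * int r)) * D n r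
      - (if even n then qint (int n) * D (n - 1) r else 0)"
  proof -
    have "r \<le> mu" using mu r by simp
    thus ?thesis unfolding D_def act_dot_t_rec by (simp only: t_act_def if_True)
  qed
  hence "pole_order_le (int n - 1) (qint (int n + 1) * D (Suc n) r)"
    using pole_order_le_diff[OF pole_order_le_add[OF pole_order_le_add[OF T1 T2] T3] T4] by (simp only:)
  from pole_order_le_mult[OF pole_order_inverse_qint[of n] this]
  have "pole_order_le (- 1) (inverse (qint (int n + 1)) * (qint (int n + 1) * D (Suc n) r))"
    by simp
  moreover have "inverse (qint (int n + 1)) * (qint (int n + 1) * D (Suc n) r) = D (Suc n) r"
    by (simp add: mult.assoc[symmetric])
  ultimately show ?case unfolding n' D_def by simp
qed

text \<open>Membership in \<open>Lam\<close> puts the lower coordinates in A and the growth bound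
  makes them vanish at infinity; together they lie in q^(-1)Z[q^(-1)]. Uniqueness then resolves
  \<open>THE\<close>.\<close>

lemma icb_eq_act_dot_t:
  assumes "2 * \<bar>l\<bar> + int n \<le> int (2 * lam)"
  shows "icb (qint (2 * l)) (2 * lam) n = act (qint (2 * l)) (2 * lam) (dot_t n) vplus"
proof -
  let ?b = "act (qint (2 * l)) (2 * lam) (dot_t n) vplus"
  have "inLA (2 * lam) ?b"
    by (rule inLA_act_Lam) (rule dot_t_in_Lam)
  hence "in_qinvZqinv (?b r)" if "r < n" for r
    using act_dot_t_pole_order[OF assms that] by (auto simp: inLA_def intro: in_qinvZqinvI)
  hence "is_icb (qint (2 * l)) (2 * lam) n ?b"
    using assms unfolding is_icb_def
    by (auto simp: ipsiL_act ipsiU_dot_t act_dot_t_above act_dot_t_top intro: inL_act inL_vplus)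
  thus ?thesis unfolding icb_def using is_icb_unique by blast
qed

section \<open>The divided powers as an A-basis\<close>

lemma AUev_diff_smult:
  assumes "x \<in> AUev \<kappa>" "y \<in> AUev \<kappa>" "inA c"
  shows "x - smult c y \<in> AUev \<kappa>"
  using assms unfolding AUev_def inLA_def inL_def
  by (auto simp: act_diff act_smult intro!: inA_diff inA_mult)

lemma inLA_vplus: "inLA mu vplus"
  using inL_vplus[of mu] by (auto simp: inLA_def vplus_def)

lemma AUev_span_dot_t:
  assumes "x \<in> AUev (qint (2 * l))" "\<forall>i\<ge>m. coeff x i = 0"
  shows "\<exists>c. (\<forall>n\<ge>m. c n = 0) \<and> (\<forall>n. inA (c n)) \<and> x = (\<Sum>n<m. smult (c n) (dot_t n))"
  using assms
proof (induction m arbitrary: x)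
  case 0
  then have "x = 0" by (intro poly_eqI) simp
  then show ?case by (intro exI[of _ "\<lambda>n. 0"]) simp
next
  case (Suc m)
  define d where "d = coeff x m * qfact m"
  have "degree x \<le> m" using Suc.prems(2) by (intro degree_le) auto
  \<comment> \<open>The module L(2m) is large enough to contain coordinate m; since x preserves its
    lattice, the candidate coefficient d lies in A.\<close>
  hence "d = act (qint (2 * l)) (2 * m) x vplus m" by (simp add: d_def act_vplus_top)
  hence d: "inA d" using Suc.prems(1) inLA_vplus unfolding AUev_def inLA_def by auto
  have "x - smult d (dot_t m) \<in> AUev (qint (2 * l))"
    using Suc.prems(1) dot_t_in_Lam Lam_subset_AUev d by (blast intro: AUev_diff_smult)
  moreover have "\<forall>i\<ge>m. coeff (x - smult d (dot_t m)) i = 0"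
  proof (intro allI impI)
    fix i assume "i \<ge> m"
    then show "coeff (x - smult d (dot_t m)) i = 0"
      using Suc.prems(2) by (cases "i = m") (auto simp: d_def dot_t_lead dot_t_above)
  qed
  ultimately obtain c where c: "\<forall>n\<ge>m. c n = 0" "\<forall>n. inA (c n)"
      "x - smult d (dot_t m) = (\<Sum>n<m. smult (c n) (dot_t n))"
    using Suc.IH by blast
  have "x = (\<Sum>n<Suc m. smult ((c(m := d)) n) (dot_t n))"
    using c(3) by (simp add: algebra_simps)
  thus ?case using c(1,2) d by (intro exI[of _ "c(m := d)"]) auto
qed

text \<open>At the largest index N of the support only \<open>dot_t N\<close> contributes to the
  coefficient of t^N.\<close>

lemma dot_t_independent:
  assumes "finite {n. c n \<noteq> 0}" "(\<Sum>n\<in>{n. c n \<noteq> 0}. smult (c n) (dot_t n)) = 0"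
  shows "c n = 0"
proof (rule ccontr)
  assume "c n \<noteq> 0"
  define S where "S = {n. c n \<noteq> 0}"
  define N where "N = Max S"
  have S: "finite S" "S \<noteq> {}" using assms(1) \<open>c n \<noteq> 0\<close> by (auto simp: S_def)
  hence N: "N \<in> S" by (simp add: N_def)
  have "0 = coeff (\<Sum>n\<in>S. smult (c n) (dot_t n)) N"
    using assms(2) by (simp add: S_def)
  also have "\<dots> = (\<Sum>n\<in>S. c n * coeff (dot_t n) N)"
    by (simp add: coeff_sum)
  also have "\<dots> = c N * coeff (dot_t N) N"
  proof (subst sum.remove[OF S(1) N], subst sum.neutral)
    show "\<forall>n\<in>S - {N}. c n * coeff (dot_t n) N = 0"
    proof
      fix n assume "n \<in> S - {N}"
      hence "n < N" using Max_ge[OF S(1), of n] by (simp add: N_def)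
      thus "c n * coeff (dot_t n) N = 0" by (simp add: dot_t_above)
    qed
  qed simp
  finally show False using N by (simp add: S_def dot_t_lead)
qed

theorem theorem2p13:
  fixes l :: int
  defines "\<kappa> \<equiv> qint (2 * l)"
  shows "(\<forall>n. \<exists>N. \<forall>lam\<ge>N.
            is_icb_element \<kappa> (2 * lam) (act \<kappa> (2 * lam) (dot_t n) vplus))
       \<and> (\<forall>n. dot_t n \<in> AUev \<kappa> \<and>
            (\<exists>N. \<forall>lam\<ge>N. act \<kappa> (2 * lam) (dot_t n) vplus = icb \<kappa> (2 * lam) n))
       \<and> (\<forall>c :: nat \<Rightarrow> qf. finite {n. c n \<noteq> 0} \<longrightarrow> (\<forall>n. inA (c n)) \<longrightarrow>
            (\<Sum>n\<in>{n. c n \<noteq> 0}. smult (c n) (dot_t n)) = 0 \<longrightarrow> (\<forall>n. c n = 0))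
       \<and> (\<forall>x\<in>AUev \<kappa>. \<exists>c :: nat \<Rightarrow> qf. finite {n. c n \<noteq> 0} \<and> (\<forall>n. inA (c n)) \<and>
            x = (\<Sum>n\<in>{n. c n \<noteq> 0}. smult (c n) (dot_t n)))"


proof (intro conjI allI impI ballI)
  fix n :: nat
  \<comment> \<open>Doubling lam \<ge> |l| + n gives the bound 2|l| + n \<le> 2 lam of
    \<open>icb_eq_act_dot_t\<close>.\<close>
  define N where "N = nat \<bar>l\<bar> + n"
  have eq: "act \<kappa> (2 * lam) (dot_t n) vplus = icb \<kappa> (2 * lam) n" and le: "n \<le> 2 * lam"
    if "lam \<ge> N" for lam
    using that icb_eq_act_dot_t[of l n lam] unfolding \<kappa>_def N_def by auto
  show "\<exists>N. \<forall>lam\<ge>N. is_icb_element \<kappa> (2 * lam) (act \<kappa> (2 * lam) (dot_t n) vplus)"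
    unfolding is_icb_element_def using eq le by blast
  show "\<exists>N. \<forall>lam\<ge>N. act \<kappa> (2 * lam) (dot_t n) vplus = icb \<kappa> (2 * lam) n"
    using eq by blast
  show "dot_t n \<in> AUev \<kappa>"
    unfolding \<kappa>_def using dot_t_in_Lam Lam_subset_AUev by blast
next
  fix c :: "nat \<Rightarrow> qf" and n
  assume "finite {n. c n \<noteq> 0}" "(\<Sum>n\<in>{n. c n \<noteq> 0}. smult (c n) (dot_t n)) = 0"
  thus "c n = 0" by (rule dot_t_independent)
next
  fix x assume x: "x \<in> AUev \<kappa>"
  have "\<forall>i\<ge>Suc (degree x). coeff x i = 0" by (simp add: coeff_eq_0)
  then obtain c where c: "\<forall>n\<ge>Suc (degree x). c n = 0" "\<forall>n. inA (c n)"
      "x = (\<Sum>n<Suc (degree x). smult (c n) (dot_t n))"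
    using AUev_span_dot_t[of x l "Suc (degree x)"] x unfolding \<kappa>_def by blast
  have sub: "{n. c n \<noteq> 0} \<subseteq> {..<Suc (degree x)}"
    using c(1) by (auto simp: not_le[symmetric])
  have "(\<Sum>n\<in>{n. c n \<noteq> 0}. smult (c n) (dot_t n)) = (\<Sum>n<Suc (degree x). smult (c n) (dot_t n))"
    using sub by (intro sum.mono_neutral_left) auto
  thus "\<exists>c. finite {n. c n \<noteq> 0} \<and> (\<forall>n. inA (c n)) \<and> x = (\<Sum>n\<in>{n. c n \<noteq> 0}. smult (c n) (dot_t n))"
    using c sub finite_subset[OF sub] by (intro exI[of _ c]) simp
qed

end
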